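(* Consider the cache-aided combination network with secure caching described in the context, with relay cache size $0\le N\le \frac Dr$. Let $t\in\{0,1,\dots,\hat K-1\}$ and $$M=\frac{tD}{\hat K-t}\Big(1-\frac{Nr}{D}\Big).$$ Then, with user cache size $M$ and relay cache size $N$, the rate pair $$R_1^c=\frac{\hat K(D+M-rN)}{r\big((\hat K+1)M+D-rN\big)}\Big(1-\frac{Nr}{D}\Big),\qquad R_2^c=\frac1r$$ is achievable under the secure caching constraint. Moreover, for fixed $N$, every point of the convex envelope of the resulting set of triples $(M,R_1^c,R_2^c)$ is achievable under this constraint.
   Context: Combination network: a server holds $D$ independent files $W_1,\dots,W_D$, each uniformly distributed over $F$ bits. There are $h$ relay nodes $\Gamma_1,\dots,\Gamma_h$ and $K=\binom{h}{r}$ end users $U_1,\dots,U_K$ ($r<h$); each user is connected to a distinct set of $r$ relays (one user per $r$-subset), so each relay is connected to $\hat K=\binom{h-1}{r-1}$ users; $\mathcal N(U_k)$ denotes the set of relays connected to user $k$. The server is connected to every relay; all links are noiseless unicast links. Assume $K\le D$. Each user has a cache of $MF$ bits, each relay a cache of $NF$ bits. Placement phase (before demands): relay caches $V_j$ and user caches $Z_k$ are filled with functions of the files (and possibly of randomness independent of the files), $H(V_j)\le NF$, $H(Z_k)\le MF$. Delivery: user $k$ requests $W_{d_k}$ for an arbitrary $\mathbf d\in\{1,\dots,D\}^K$; the server sends relay $\Gamma_i$ a signal $X_{i,\mathbf d}$ of $R_1F$ bits; relay $\Gamma_i$ sends each connected user $k$ a signal $Y_{i,\mathbf d,k}$ of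 $R_2F$ bits, a function of $X_{i,\mathbf d}$, $V_i$, $\mathbf d$; user $k$ decodes $W_{d_k}$ from $Z_k$, $\mathbf d$ and $\{Y_{j,\mathbf d,k}:j\in\mathcal N(U_k)\}$. Secure caching: with $\mathbf W_{-d_k}$ the set of all files other than $W_{d_k}$, require $\max_{\mathbf d,k} I(\mathbf W_{-d_k};\{Y_{j,\mathbf d,k}:j\in\mathcal N(U_k)\},Z_k)<\delta$. A pair is achievable under secure caching if for every $\epsilon,\delta>0$ and all sufficiently large $F$ there is a scheme with these rates, $\max_{\mathbf d,k}P(\hat W_{d_k}\ne W_{d_k})<\epsilon$, and the secure caching condition with $\delta$. *)

theory Defs
  imports "HOL-Probability.Probability"
begin

definition files :: "nat \<Rightarrow> nat \<Rightarrow> bool list list set" where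
  "files D F = {ws. length ws = D \<and> (\<forall>w\<in>set ws. length w = F)}"

(* Users are identified with the r-subsets of the relays {0..<h}; N(U_S) = S. *)
definition users :: "nat \<Rightarrow> nat \<Rightarrow> nat set set" where
  "users h r = {S. S \<subseteq> {..<h} \<and> card S = r}"

definition demands :: "nat \<Rightarrow> nat \<Rightarrow> nat \<Rightarrow> (nat set \<Rightarrow> nat) set" where
  "demands h r D = {d. \<forall>S\<in>users h r. d S < D}"

definition ent :: "'a pmf \<Rightarrow> ('a \<Rightarrow> 'b) \<Rightarrow> real" where
  "ent P X = (\<Sum>y\<in>X ` set_pmf P. - pmf (map_pmf X P) y * log 2 (pmf (map_pmf X P) y))"

definition mi :: "'a pmf \<Rightarrow> ('a \<Rightarrow> 'b) \<Rightarrow> ('a \<Rightarrow> 'c) \<Rightarrow> real" where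
  "mi P X Y = ent P X + ent P Y - ent P (\<lambda>\<omega>. (X \<omega>, Y \<omega>))"

(* Achievability of (M, N, R1, R2) under secure caching.
   Sample space: (files, placement/delivery randomness u), files uniform on files D F,
   u ~ rho independent of the files.
   V j : relay cache, Z S : user cache, X j d : server -> relay j signal,
   Y j d S x v : relay j -> user S signal (function of X_{j,d}, V_j, d),
   dec d S z y : decoder of user S from Z_S, d and the signals of the relays in S. *)
definition secure_achievable ::
  "nat \<Rightarrow> nat \<Rightarrow> nat \<Rightarrow> real \<Rightarrow> real \<Rightarrow> real \<Rightarrow> real \<Rightarrow> bool" where
  "secure_achievable h r D M N R1 R2 \<longleftrightarrow>
    (\<forall>\<epsilon>>0. \<forall>\<delta>>0. \<exists>F0. \<forall>F\<ge>F0.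
      \<exists>(\<rho> :: nat pmf)
       (V :: nat \<Rightarrow> bool list list \<Rightarrow> nat \<Rightarrow> bool list)
       (Z :: nat set \<Rightarrow> bool list list \<Rightarrow> nat \<Rightarrow> bool list)
       (X :: nat \<Rightarrow> (nat set \<Rightarrow> nat) \<Rightarrow> bool list list \<Rightarrow> nat \<Rightarrow> bool list)
       (Y :: nat \<Rightarrow> (nat set \<Rightarrow> nat) \<Rightarrow> nat set \<Rightarrow> bool list \<Rightarrow> bool list \<Rightarrow> bool list)
       (dec :: (nat set \<Rightarrow> nat) \<Rightarrow> nat set \<Rightarrow> bool list \<Rightarrow> (nat \<Rightarrow> bool list) \<Rightarrow> bool list).
        finite (set_pmf \<rho>) \<and>
        (let P = pair_pmf (pmf_of_set (files D F)) \<rho>;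
             rcv = (\<lambda>d S ws u. (\<lambda>j. if j \<in> S then Y j d S (X j d ws u) (V j ws u) else []))
         in (\<forall>j<h. ent P (\<lambda>(ws, u). V j ws u) \<le> N * real F) \<and>
            (\<forall>S\<in>users h r. ent P (\<lambda>(ws, u). Z S ws u) \<le> M * real F) \<and>
            (\<forall>j d ws u. length (X j d ws u) \<le> nat \<lceil>R1 * real F\<rceil>) \<and>
            (\<forall>j d S x v. length (Y j d S x v) \<le> nat \<lceil>R2 * real F\<rceil>) \<and>
            (\<forall>d\<in>demands h r D. \<forall>S\<in>users h r.
               measure_pmf.prob P {(ws, u). dec d S (Z S ws u) (rcv d S ws u) \<noteq> ws ! d S} < \<epsilon> \<and>
               mi P (\<lambda>(ws, u). nths ws (- {d S}))
                    (\<lambda>(ws, u). (Z S ws u, rcv d S ws u)) < \<delta>)))"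

definition Khat :: "nat \<Rightarrow> nat \<Rightarrow> nat" where
  "Khat h r = (h - 1) choose (r - 1)"

definition Mc :: "nat \<Rightarrow> nat \<Rightarrow> nat \<Rightarrow> real \<Rightarrow> nat \<Rightarrow> real" where
  "Mc h r D N t = real t * real D / (real (Khat h r) - real t) * (1 - N * real r / real D)"

definition R1c :: "nat \<Rightarrow> nat \<Rightarrow> nat \<Rightarrow> real \<Rightarrow> nat \<Rightarrow> real" where
  "R1c h r D N t = (let M = Mc h r D N t; K = real (Khat h r) in
     K * (real D + M - real r * N) / (real r * ((K + 1) * M + real D - real r * N))
       * (1 - N * real r / real D))"

end

theory Submission
  imports Defs "HOL-Number_Theory.Cong" "HOL-Computational_Algebra.Polynomial"
begin

text \<open>
  Every file is cut into a part of about \<open>N r F / D\<close> bits and, for time sharing with weights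
  \<open>\<tau> s\<close>, parts of about \<open>\<tau> s (1 - N r / D) F\<close> bits. Each part is encoded by a Reed-Solomon code
  across the relays, any \<open>r\<close> of which determine it. The relays cache their symbols of the first part.
  A relay symbol of part \<open>s\<close> is secret-shared among the \<open>s\<close>-subsets of the users of that relay; a user
  caches the shares of the subsets it belongs to, and the server sends to the relay, for each
  \<open>(s + 1)\<close>-subset \<open>T\<close>, the sum over \<open>S \<in> T\<close> of the share \<open>T - {S}\<close> of the file that \<open>S\<close> requests. The relay
  forwards to a user only the sums involving it, so no keys are needed. Changing the files that a user
  did not request can be undone, in the view of that user, by a translation of the randomness;
  hence the leakage is exactly zero.

  The rates have to hold for every large \<open>F\<close> without divisibility assumptions. The symbols are
  therefore residues modulo integers just below the ideal (real) alphabet sizes, chosen coprime to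
  all differences of evaluation points so that Vandermonde systems remain solvable. The files outside
  the resulting alphabet form a vanishing fraction and account for the decoding error.
\<close>

section \<open>Polynomial evaluation modulo an integer\<close>

text \<open>Modulo a composite \<open>p\<close> a polynomial may have more roots than its degree;
  root differences coprime to \<open>p\<close> restore the usual count. Splitting off
  \<open>x\<close> by synthetic division leaves \<open>p dvd (y - x) * poly g y\<close>, and
  coprimality cancels \<open>y - x\<close>.\<close>

lemma const_dvd_poly_if_roots:
  fixes f :: "int poly"
  assumes "finite A" and "degree f < card A" and "\<And>x. x \<in> A \<Longrightarrow> p dvd poly f x"
    and "\<And>x y. x \<in> A \<Longrightarrow> y \<in> A \<Longrightarrow> x \<noteq> y \<Longrightarrow> coprime p (x - y)"
  shows "[:p:] dvd f"
  using assms
proof (induction "degree f" arbitrary: f A)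
  case 0
  then obtain a where f: "f = [:a:]"
    using degree_eq_zeroE by metis
  have "A \<noteq> {}" using 0 by auto
  then obtain x where "x \<in> A" by blast
  then have "p dvd a" using 0(4)[of x] f by simp
  then show ?case by (simp add: f)
next
  case (Suc n)
  have "A \<noteq> {}" using Suc.prems by auto
  then obtain x where x: "x \<in> A" by blast
  define g where "g = synthetic_div f x"
  have f: "f = [:poly f x:] + [:-x, 1:] * g"
    using synthetic_div_correct'[of x f] by (simp add: g_def add.commute)
  have "[:p:] dvd g"
  proof (rule Suc.hyps(1))
    show "n = degree g" using Suc.hyps(2) by (simp add: g_def degree_synthetic_div)
    show "finite (A - {x})" using Suc.prems by simp
    show "degree g < card (A - {x})"
      using Suc.prems(1,2) Suc.hyps(2) x by (simp add: g_def degree_synthetic_div)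
    show "coprime p (y - z)" if "y \<in> A - {x}" "z \<in> A - {x}" "y \<noteq> z" for y z
      using Suc.prems(4) that by blast
    show "p dvd poly g y" if y: "y \<in> A - {x}" for y
    proof -
      have "poly f y = poly f x + (y - x) * poly g y"
        by (subst f) (simp add: algebra_simps)
      moreover have "p dvd poly f y" "p dvd poly f x" using Suc.prems(3) x y by auto
      ultimately have "p dvd (y - x) * poly g y" by (metis dvd_add_right_iff)
      moreover have "coprime p (y - x)" using Suc.prems(4) x y by auto
      ultimately show ?thesis by (simp add: coprime_dvd_mult_right_iff)
    qed
  qed
  moreover have "[:p:] dvd [:poly f x:]" using Suc.prems(3) x by simp
  ultimately show ?case by (subst f) (intro dvd_add dvd_mult)
qed

definition pev :: "nat \<Rightarrow> (nat \<Rightarrow> int) \<Rightarrow> int \<Rightarrow> int" where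
  "pev m c x = (\<Sum>l<m. c l * x ^ l)"

text \<open>Separates the random low-order coefficients of a sharing polynomial from the message
  coefficients above them.\<close>

lemma pev_split:
  assumes "a \<le> m"
  shows "pev m (\<lambda>l. if l < a then u l else g (l - a)) x = pev a u x + x ^ a * pev (m - a) g x"
proof -
  define k where "k = m - a"
  have m: "m = a + k" using assms by (simp add: k_def)
  have "(\<Sum>l<k. (if a + l < a then u (a + l) else g (a + l - a)) * x ^ (a + l)) = x ^ a * (\<Sum>l<k. g l * x ^ l)"
    by (simp add: sum_distrib_left power_add mult.left_commute)
  moreover have "(\<Sum>l<a + k. h l) = (\<Sum>l<a. h l) + (\<Sum>l<k. h (a + l))" for h :: "nat \<Rightarrow> int"
    by (induction k) (auto simp: ac_simps)
  ultimately show ?thesis by (simp add: m pev_def)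
qed

text \<open>The difference of the two polynomials has degree below the number of nodes, so the root
  count makes all its coefficients divisible by \<open>p\<close>. Decoding rests on this.\<close>

lemma pev_inj_mod:
  assumes A: "finite A" "m \<le> card A"
    and cop: "\<And>x y. x \<in> A \<Longrightarrow> y \<in> A \<Longrightarrow> x \<noteq> y \<Longrightarrow> coprime p (x - y)"
    and eq: "\<And>x. x \<in> A \<Longrightarrow> [pev m c x = pev m c' x] (mod p)"
    and l: "l < m"
  shows "[c l = c' l] (mod p)"
proof -
  define f where "f = (\<Sum>l<m. monom (c l - c' l) l)"
  have "degree f < card A"
  proof -
    have "degree f \<le> m - 1" unfolding f_def
      by (intro degree_sum_le) (auto intro: order.trans[OF degree_monom_le])
    then show ?thesis using l A by simp
  qed
  moreover have "p dvd poly f x" if "x \<in> A" for x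
  proof -
    have "poly f x = pev m c x - pev m c' x"
      by (simp add: f_def pev_def poly_sum poly_monom algebra_simps sum_subtractf)
    then show ?thesis using eq[OF that] by (simp add: cong_iff_dvd_diff)
  qed
  ultimately have "[:p:] dvd f" using const_dvd_poly_if_roots A(1) cop by blast
  then have "p dvd coeff f l" by (simp add: const_poly_dvd_iff)
  moreover have "coeff f l = c l - c' l"
    using l by (simp add: f_def coeff_sum sum.delta)
  ultimately show ?thesis by (simp add: cong_iff_dvd_diff)
qed

text \<open>By counting: evaluation at \<open>m\<close> nodes is injective on coefficient vectors of
  residues, and there are equally many vectors of values. Secrecy rests on this.\<close>

lemma pev_surj_mod:
  fixes p :: int
  assumes A: "finite A" "card A = m" and p: "0 < p"
    and cop: "\<And>x y. x \<in> A \<Longrightarrow> y \<in> A \<Longrightarrow> x \<noteq> y \<Longrightarrow> coprime p (x - y)"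
  shows "\<exists>c. \<forall>x\<in>A. [pev m c x = y x] (mod p)"
proof -
  define \<Phi> where "\<Phi> c = restrict (\<lambda>x. pev m c x mod p) A" for c
  define C where "C = PiE {..<m} (\<lambda>_. {0..<p})"
  define E where "E = PiE A (\<lambda>_. {0..<p})"
  have "inj_on \<Phi> C"
  proof (rule inj_onI)
    fix c c' assume c: "c \<in> C" "c' \<in> C" "\<Phi> c = \<Phi> c'"
    have "[pev m c x = pev m c' x] (mod p)" if "x \<in> A" for x
      using fun_cong[OF c(3), of x] that by (simp add: \<Phi>_def cong_def)
    note eq = this
    have "[c l = c' l] (mod p)" if "l < m" for l
      by (rule pev_inj_mod[OF A(1) eq_refl[OF A(2)[symmetric]] cop eq that])
    moreover have "0 \<le> c l" "c l < p" "0 \<le> c' l" "c' l < p" if "l < m" for l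
      using c that by (auto simp: C_def PiE_iff)
    ultimately have "c l = c' l" if "l < m" for l
      using that by (simp add: cong_def)
    then show "c = c'" using c by (intro PiE_ext[of c "{..<m}"]) (auto simp: C_def)
  qed
  then have "card (\<Phi> ` C) = card E"
    using A by (simp add: card_image C_def E_def card_PiE)
  moreover have "\<Phi> ` C \<subseteq> E" using p by (auto simp: \<Phi>_def E_def)
  moreover have "finite E" using A by (auto simp: E_def intro!: finite_PiE)
  ultimately have "\<Phi> ` C = E" by (simp add: card_subset_eq)
  moreover have "restrict (\<lambda>x. y x mod p) A \<in> E" using p by (auto simp: E_def)
  ultimately obtain c where c: "\<Phi> c = restrict (\<lambda>x. y x mod p) A" by (metis imageE)
  have "[pev m c x = y x] (mod p)" if "x \<in> A" for x
    using fun_cong[OF c, of x] that by (simp add: \<Phi>_def cong_def)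
  then show ?thesis by blast
qed

text \<open>Such a \<open>k\<close> divides \<open>fact b\<close>, to which \<open>p\<close> is
  coprime. One congruence thus handles all bounded differences of evaluation points at once.\<close>

lemma coprime_if_cong_1_mod_fact:
  fixes p k :: int
  assumes "[p = 1] (mod fact b)" and "k \<noteq> 0" and "\<bar>k\<bar> \<le> int b"
  shows "coprime p k"
proof -
  have "nat \<bar>k\<bar> dvd fact b" using assms by (intro dvd_fact) auto
  then have "int (nat \<bar>k\<bar>) dvd int (fact b)" by (simp only: int_dvd_int_iff)
  then have "k dvd fact b" by simp
  moreover have "coprime p (fact b)"
    using assms(1) by (metis cong_imp_coprime cong_sym coprime_1_left)
  ultimately show ?thesis by (metis coprime_divisors dvd_refl)
qed

section \<open>Entropy and uniform files\<close>

lemma ent_altdef: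
  "ent P X = (\<Sum>y\<in>set_pmf (map_pmf X P). - pmf (map_pmf X P) y * log 2 (pmf (map_pmf X P) y))"
  by (simp add: ent_def)

text \<open>Gibbs' inequality against the uniform law on \<open>A\<close>, from
  \<open>ln x \<le> x - 1\<close>. It bounds cache entropies by the sizes of the cache
  alphabets.\<close>

lemma ent_le_log_card:
  assumes fin: "finite (set_pmf P)" and A: "finite A" "X ` set_pmf P \<subseteq> A"
  shows "ent P X \<le> log 2 (card A)"
proof -
  define Q where "Q = map_pmf X P"
  define n where "n = real (card A)"
  have Q: "finite (set_pmf Q)" "set_pmf Q \<subseteq> A" using fin A by (auto simp: Q_def)
  have le: "card (set_pmf Q) \<le> card A" using Q A by (intro card_mono)
  have "card (set_pmf Q) > 0" using Q by (simp add: card_gt_0_iff set_pmf_not_empty)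
  with le have n: "n > 0" by (simp add: n_def)
  have sum1: "(\<Sum>y\<in>set_pmf Q. pmf Q y) = 1" using Q by (intro sum_pmf_eq_1) auto
  have "ent P X - log 2 n = (\<Sum>y\<in>set_pmf Q. - pmf Q y * log 2 (pmf Q y)) - (\<Sum>y\<in>set_pmf Q. pmf Q y) * log 2 n"
    by (simp only: sum1 ent_altdef Q_def[symmetric] mult_1)
  also have "\<dots> = (\<Sum>y\<in>set_pmf Q. - pmf Q y * log 2 (pmf Q y) - pmf Q y * log 2 n)"
    by (simp add: sum_subtractf sum_distrib_right)
  also have "\<dots> \<le> (\<Sum>y\<in>set_pmf Q. (1 / n - pmf Q y) / ln 2)"
  proof (rule sum_mono)
    fix y assume "y \<in> set_pmf Q"
    then have y: "pmf Q y > 0" by (simp add: pmf_positive)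
    have "ln (1 / (n * pmf Q y)) \<le> 1 / (n * pmf Q y) - 1"
      using y n by (intro ln_le_minus_one) simp
    then have "pmf Q y * ln (1 / (n * pmf Q y)) \<le> pmf Q y * (1 / (n * pmf Q y) - 1)"
      using y by (intro mult_left_mono) auto
    also have "\<dots> = 1 / n - pmf Q y" using y n by (simp add: field_simps)
    finally have "pmf Q y * ln (1 / (n * pmf Q y)) / ln 2 \<le> (1 / n - pmf Q y) / ln 2"
      by (intro divide_right_mono) auto
    moreover have "- pmf Q y * log 2 (pmf Q y) - pmf Q y * log 2 n = pmf Q y * ln (1 / (n * pmf Q y)) / ln 2"
      using y n by (simp add: log_def ln_div ln_mult field_simps)
    ultimately show "- pmf Q y * log 2 (pmf Q y) - pmf Q y * log 2 n \<le> (1 / n - pmf Q y) / ln 2"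
      by simp
  qed
  also have "\<dots> = (real (card (set_pmf Q)) / n - 1) / ln 2"
    by (simp add: sum_divide_distrib[symmetric] sum_subtractf sum1)
  also have "\<dots> \<le> 0" using le n by (simp add: n_def divide_simps)
  finally show ?thesis by (simp add: n_def)
qed

text \<open>The logarithm of a product turns the joint entropy into a sum. Any product law will do,
  since \<open>\<alpha>\<close> and \<open>\<beta>\<close> are then forced to be the
  marginals.\<close>

lemma mi_eq_0_if_pair_pmf:
  assumes fin: "finite (set_pmf P)" and eq: "map_pmf (\<lambda>\<omega>. (X \<omega>, Y \<omega>)) P = pair_pmf \<alpha> \<beta>"
  shows "mi P X Y = 0"
proof -
  have X: "map_pmf X P = \<alpha>"
    using arg_cong[OF eq, of "map_pmf fst"] by (simp add: map_fst_pair_pmf pmf.map_comp o_def)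
  have Y: "map_pmf Y P = \<beta>"
    using arg_cong[OF eq, of "map_pmf snd"] by (simp add: map_snd_pair_pmf pmf.map_comp o_def)
  have f: "finite (set_pmf \<alpha>)" "finite (set_pmf \<beta>)" using fin by (auto simp flip: X Y)
  have s: "(\<Sum>a\<in>set_pmf \<alpha>. pmf \<alpha> a) = 1" "(\<Sum>b\<in>set_pmf \<beta>. pmf \<beta> b) = 1"
    using f by (auto intro!: sum_pmf_eq_1)
  have "ent P (\<lambda>\<omega>. (X \<omega>, Y \<omega>)) =
    (\<Sum>(a, b)\<in>set_pmf \<alpha> \<times> set_pmf \<beta>. - (pmf \<alpha> a * pmf \<beta> b) * log 2 (pmf \<alpha> a * pmf \<beta> b))"
    unfolding ent_altdef eq by (simp add: pmf_pair case_prod_unfold)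
      (intro sum.cong refl, metis pmf_pair prod.collapse)
  also have "\<dots> = (\<Sum>(a, b)\<in>set_pmf \<alpha> \<times> set_pmf \<beta>.
      (- pmf \<alpha> a * log 2 (pmf \<alpha> a)) * pmf \<beta> b + pmf \<alpha> a * (- pmf \<beta> b * log 2 (pmf \<beta> b)))"
    by (intro sum.cong refl) (auto simp: log_mult pmf_positive set_pmf_iff algebra_simps)
  also have "\<dots> = (\<Sum>a\<in>set_pmf \<alpha>. - pmf \<alpha> a * log 2 (pmf \<alpha> a)) * (\<Sum>b\<in>set_pmf \<beta>. pmf \<beta> b)
      + (\<Sum>a\<in>set_pmf \<alpha>. pmf \<alpha> a) * (\<Sum>b\<in>set_pmf \<beta>. - pmf \<beta> b * log 2 (pmf \<beta> b))"
    by (simp only: sum.cartesian_product[symmetric] sum.distrib sum_product)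
  also have "\<dots> = ent P X + ent P Y" by (simp only: s ent_altdef X Y mult_1 mult_1_right)
  finally show ?thesis by (simp add: mi_def)
qed

section \<open>Uniformly distributed files and their resampling\<close>

abbreviation words :: "nat \<Rightarrow> bool list set" where
  "words F \<equiv> {w. length w = F}"

lemma finite_words: "finite (words F)"
  and card_words: "card (words F) = 2 ^ F"
  using finite_lists_length_eq[of "UNIV :: bool set" F] card_lists_length_eq[of "UNIV :: bool set" F]
  by simp_all

lemma words_nonempty: "words F \<noteq> {}"
  using Ex_list_of_length by auto

lemma finite_files: "finite (files D F)"
proof -
  have "files D F = {ws. set ws \<subseteq> (words F) \<and> length ws = D}" by (auto simp: files_def)
  then show ?thesis using finite_lists_length_eq[OF finite_words] by simp
qed

lemma files_nonempty: "files D F \<noteq> {}"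
proof -
  have "replicate D (replicate F True) \<in> files D F" by (auto simp: files_def)
  then show ?thesis by blast
qed

lemma files_nth: "ws \<in> files D F \<Longrightarrow> k < D \<Longrightarrow> length (ws ! k) = F"
  by (auto simp: files_def)

lemma files_update: "ws \<in> files D F \<Longrightarrow> length w = F \<Longrightarrow> ws[k := w] \<in> files D F"
  by (auto simp: files_def dest!: subsetD[OF set_update_subset_insert])

text \<open>The exchange of file \<open>k\<close> with an extra word is an involution, hence
  preserves the uniform law on pairs; the two projections give \<open>resample_file\<close> and
  \<open>file_uniform\<close>.\<close>

lemma swap_file_bij:
  assumes "k < D"
  shows "bij_betw (\<lambda>(ws, w). (ws[k := w], ws ! k))
    (files D F \<times> words F) (files D F \<times> words F)"
proof (rule bij_betw_byWitness[where f' = "\<lambda>(ws, w). (ws[k := w], ws ! k)"])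
qed (use assms in \<open>auto simp: files_update files_nth\<close>, auto simp: files_def)

lemma pair_pmf_of_set:
  assumes "finite A" "A \<noteq> {}" "finite B" "B \<noteq> {}"
  shows "pair_pmf (pmf_of_set A) (pmf_of_set B) = pmf_of_set (A \<times> B)"
proof (rule pmf_eqI)
  fix x :: "'a \<times> 'b"
  show "pmf (pair_pmf (pmf_of_set A) (pmf_of_set B)) x = pmf (pmf_of_set (A \<times> B)) x"
    using assms by (cases x) (simp add: pmf_pair card_cartesian_product indicator_def)
qed

lemma swap_file_pmf:
  fixes F :: nat
  assumes "k < D"
  defines "P \<equiv> pair_pmf (pmf_of_set (files D F)) (pmf_of_set (words F))"
  shows "map_pmf (\<lambda>(ws, w). (ws[k := w], ws ! k)) P = P"
proof -
  have "P = pmf_of_set (files D F \<times> words F)"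
    unfolding P_def by (intro pair_pmf_of_set finite_files files_nonempty finite_words words_nonempty)
  moreover have ne: "files D F \<times> words F \<noteq> {}"
    using files_nonempty words_nonempty unfolding Sigma_empty_iff by blast
  moreover have fin: "finite (files D F \<times> words F)"
    by (intro finite_cartesian_product finite_files finite_words)
  ultimately show ?thesis
    using map_pmf_of_set_bij_betw[OF swap_file_bij[OF assms(1), of F] ne fin] by simp
qed

lemma resample_file:
  assumes "k < D"
  shows "map_pmf (\<lambda>(ws, w). ws[k := w])
    (pair_pmf (pmf_of_set (files D F)) (pmf_of_set (words F))) = pmf_of_set (files D F)"
proof -
  let ?P = "pair_pmf (pmf_of_set (files D F)) (pmf_of_set (words F))"
  have "map_pmf (\<lambda>(ws, w). ws[k := w]) ?P = map_pmf fst (map_pmf (\<lambda>(ws, w). (ws[k := w], ws ! k)) ?P)"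
    by (simp add: pmf.map_comp o_def case_prod_unfold)
  then show ?thesis by (simp add: swap_file_pmf[OF assms] map_fst_pair_pmf)
qed

lemma file_uniform:
  assumes "k < D"
  shows "map_pmf (\<lambda>ws. ws ! k) (pmf_of_set (files D F)) = pmf_of_set (words F)"
proof -
  let ?P = "pair_pmf (pmf_of_set (files D F)) (pmf_of_set (words F))"
  have "map_pmf (\<lambda>ws. ws ! k) (pmf_of_set (files D F)) = map_pmf (\<lambda>ws. ws ! k) (map_pmf fst ?P)"
    by (simp add: map_fst_pair_pmf)
  also have "\<dots> = map_pmf snd (map_pmf (\<lambda>(ws, w). (ws[k := w], ws ! k)) ?P)"
    by (simp add: pmf.map_comp o_def case_prod_unfold)
  finally show ?thesis by (simp add: swap_file_pmf[OF assms] map_snd_pair_pmf)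
qed

lemma nths_Compl_update: "nths (ws[k := w]) (- {k}) = nths ws (- {k})"
proof (induction ws arbitrary: k)
  case (Cons x ws)
  have "{j. Suc j \<in> - {Suc k}} = - {k}" for k by auto
  with Cons show ?case by (cases k) (simp_all add: nths_Cons)
qed simp

text \<open>Drawing file \<open>k\<close> afresh changes neither the law of the files nor the other
  files. The law of the view then depends only on the fresh word, which is independent of the other
  files, so the joint law is a product.\<close>

lemma mi_other_files_eq_0:
  assumes k: "k < D" and fin: "finite (set_pmf \<rho>)"
    and view: "\<And>ws ws'. ws \<in> files D F \<Longrightarrow> ws' \<in> files D F \<Longrightarrow> ws ! k = ws' ! k \<Longrightarrow>
      map_pmf (view ws) \<rho> = map_pmf (view ws') \<rho>"
  shows "mi (pair_pmf (pmf_of_set (files D F)) \<rho>) (\<lambda>(ws, u). nths ws (- {k})) (\<lambda>(ws, u). view ws u) = 0"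
proof -
  let ?U = "pmf_of_set (files D F)"
  let ?W = "pmf_of_set (words F)"
  have finP: "finite (set_pmf (pair_pmf ?U \<rho>))"
    using fin by (simp add: finite_files files_nonempty)
  obtain ws0 where ws0: "ws0 \<in> files D F" using files_nonempty by blast
  have "map_pmf (\<lambda>\<omega>. (case \<omega> of (ws, u) \<Rightarrow> nths ws (- {k}), case \<omega> of (ws, u) \<Rightarrow> view ws u)) (pair_pmf ?U \<rho>)
      = bind_pmf ?U (\<lambda>ws. map_pmf (Pair (nths ws (- {k}))) (map_pmf (view ws) \<rho>))"
    by (simp add: pair_pmf_def map_bind_pmf map_pmf_def bind_assoc_pmf bind_return_pmf)
  also have "\<dots> = bind_pmf (map_pmf (\<lambda>(ws, w). ws[k := w]) (pair_pmf ?U ?W))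
      (\<lambda>ws. map_pmf (Pair (nths ws (- {k}))) (map_pmf (view ws) \<rho>))"
    by (simp add: resample_file[OF k])
  also have "\<dots> = bind_pmf ?U (\<lambda>ws. bind_pmf ?W (\<lambda>w.
      map_pmf (Pair (nths ws (- {k}))) (map_pmf (view (ws[k := w])) \<rho>)))"
    by (simp add: pair_pmf_def map_bind_pmf bind_map_pmf bind_assoc_pmf bind_return_pmf map_pmf_def[of "\<lambda>(ws, w). ws[k := w]"] nths_Compl_update)
  \<comment> \<open>The fixed list \<open>ws0\<close> stands in for \<open>ws\<close>: the law of
    the view sees only entry \<open>k\<close>, which is \<open>w\<close> in both lists.\<close>
  also have "\<dots> = bind_pmf ?U (\<lambda>ws. bind_pmf ?W (\<lambda>w.
      map_pmf (Pair (nths ws (- {k}))) (map_pmf (view (ws0[k := w])) \<rho>)))"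
  proof (intro bind_pmf_cong refl, goal_cases)
    case (1 ws w)
    then have "ws \<in> files D F" "length w = F"
      using set_pmf_of_set[OF words_nonempty finite_words, of F]
      by (simp_all only: mem_Collect_eq set_pmf_of_set[OF files_nonempty finite_files])
    then have "map_pmf (view (ws[k := w])) \<rho> = map_pmf (view (ws0[k := w])) \<rho>"
      using ws0 k by (intro view) (auto simp: files_update, auto simp: files_def)
    then show ?case by simp
  qed
  also have "\<dots> = pair_pmf (map_pmf (\<lambda>ws. nths ws (- {k})) ?U) (bind_pmf ?W (\<lambda>w. map_pmf (view (ws0[k := w])) \<rho>))"
    by (simp add: pair_pmf_def map_pmf_def bind_assoc_pmf bind_return_pmf)
  finally show ?thesis by (rule mi_eq_0_if_pair_pmf[OF finP])
qed

text \<open>The length bound covers every argument because the rate constraints range over all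
  inputs, not only over valid signals.\<close>

lemma ex_bit_encoder:
  assumes "finite A" "card A \<le> 2 ^ L"
  shows "\<exists>e :: 'a \<Rightarrow> bool list. inj_on e A \<and> (\<forall>x. length (e x) \<le> L)"
proof -
  have "card A \<le> card (words L)" using assms by (simp add: card_words)
  then obtain e where e: "inj_on e A" "e ` A \<subseteq> words L"
    using assms(1) finite_words card_le_inj by blast
  show ?thesis
    by (rule exI[of _ "\<lambda>x. if x \<in> A then e x else []"]) (use e in \<open>auto simp: inj_on_def\<close>)
qed

section \<open>From symbols to bits\<close>

text \<open>The existential part of \<open>secure_achievable\<close> at one file length
  \<open>F\<close>, so that schemes can be built for each \<open>F\<close> separately.\<close>

definition block_scheme ::
  "nat \<Rightarrow> nat \<Rightarrow> nat \<Rightarrow> nat \<Rightarrow> real \<Rightarrow> real \<Rightarrow> real \<Rightarrow> real \<Rightarrow> real \<Rightarrow> real \<Rightarrow> bool" where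
  "block_scheme h r D F M N R1 R2 \<epsilon> \<delta> \<longleftrightarrow>
     (\<exists>(\<rho> :: nat pmf)
       (V :: nat \<Rightarrow> bool list list \<Rightarrow> nat \<Rightarrow> bool list)
       (Z :: nat set \<Rightarrow> bool list list \<Rightarrow> nat \<Rightarrow> bool list)
       (X :: nat \<Rightarrow> (nat set \<Rightarrow> nat) \<Rightarrow> bool list list \<Rightarrow> nat \<Rightarrow> bool list)
       (Y :: nat \<Rightarrow> (nat set \<Rightarrow> nat) \<Rightarrow> nat set \<Rightarrow> bool list \<Rightarrow> bool list \<Rightarrow> bool list)
       (dec :: (nat set \<Rightarrow> nat) \<Rightarrow> nat set \<Rightarrow> bool list \<Rightarrow> (nat \<Rightarrow> bool list) \<Rightarrow> bool list).
        finite (set_pmf \<rho>) \<and>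
        (let P = pair_pmf (pmf_of_set (files D F)) \<rho>;
             rcv = (\<lambda>d S ws u. (\<lambda>j. if j \<in> S then Y j d S (X j d ws u) (V j ws u) else []))
         in (\<forall>j<h. ent P (\<lambda>(ws, u). V j ws u) \<le> N * real F) \<and>
            (\<forall>S\<in>users h r. ent P (\<lambda>(ws, u). Z S ws u) \<le> M * real F) \<and>
            (\<forall>j d ws u. length (X j d ws u) \<le> nat \<lceil>R1 * real F\<rceil>) \<and>
            (\<forall>j d S x v. length (Y j d S x v) \<le> nat \<lceil>R2 * real F\<rceil>) \<and>
            (\<forall>d\<in>demands h r D. \<forall>S\<in>users h r.
               measure_pmf.prob P {(ws, u). dec d S (Z S ws u) (rcv d S ws u) \<noteq> ws ! d S} < \<epsilon> \<and>
               mi P (\<lambda>(ws, u). nths ws (- {d S}))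
                    (\<lambda>(ws, u). (Z S ws u, rcv d S ws u)) < \<delta>)))"

lemma secure_achievable_iff:
  "secure_achievable h r D M N R1 R2 \<longleftrightarrow>
    (\<forall>\<epsilon>>0. \<forall>\<delta>>0. \<exists>F0. \<forall>F\<ge>F0. block_scheme h r D F M N R1 R2 \<epsilon> \<delta>)"
  unfolding secure_achievable_def block_scheme_def ..

text \<open>Every signal is encoded injectively, so a view in bits carries the same information as a
  view in symbols. Only words that encode no file symbol cause errors, whence the bound on
  \<open>card A / 2 ^ F\<close>.\<close>

lemma block_scheme_if_symbol_scheme:
  fixes h r D F :: nat and N M R1 R2 \<epsilon> \<delta> :: real
    and \<Omega> :: "'u set" and A :: "'a set" and Vs :: "nat \<Rightarrow> 'v set" and Zs :: "nat set \<Rightarrow> 'z set"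
    and Xs :: "nat \<Rightarrow> 'x set" and Ys :: "nat \<Rightarrow> nat set \<Rightarrow> 'y set"
    and V :: "nat \<Rightarrow> (nat \<Rightarrow> 'a) \<Rightarrow> 'u \<Rightarrow> 'v"
    and Z :: "nat set \<Rightarrow> (nat \<Rightarrow> 'a) \<Rightarrow> 'u \<Rightarrow> 'z"
    and X :: "nat \<Rightarrow> (nat set \<Rightarrow> nat) \<Rightarrow> (nat \<Rightarrow> 'a) \<Rightarrow> 'u \<Rightarrow> 'x"
    and Y :: "nat \<Rightarrow> (nat set \<Rightarrow> nat) \<Rightarrow> nat set \<Rightarrow> 'x \<Rightarrow> 'v \<Rightarrow> 'y"
  defines "view \<equiv> \<lambda>d S f u. (Z S f u, restrict (\<lambda>j. Y j d S (X j d f u) (V j f u)) S)"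
  assumes \<Omega>: "finite \<Omega>" "\<Omega> \<noteq> {}"
    and A: "finite A" "A \<noteq> {}" "card A \<le> 2 ^ F" "1 - card A / 2 ^ F < \<epsilon>" and \<delta>: "0 < \<delta>"
    and V: "\<And>j f u. j < h \<Longrightarrow> f \<in> {..<D} \<rightarrow> A \<Longrightarrow> u \<in> \<Omega> \<Longrightarrow> V j f u \<in> Vs j"
    and Vs: "\<And>j. j < h \<Longrightarrow> finite (Vs j)" "\<And>j. j < h \<Longrightarrow> log 2 (card (Vs j)) \<le> N * F"
    and Z: "\<And>S f u. S \<in> users h r \<Longrightarrow> f \<in> {..<D} \<rightarrow> A \<Longrightarrow> u \<in> \<Omega> \<Longrightarrow> Z S f u \<in> Zs S"
    and Zs: "\<And>S. S \<in> users h r \<Longrightarrow> finite (Zs S)"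
      "\<And>S. S \<in> users h r \<Longrightarrow> log 2 (card (Zs S)) \<le> M * F"
    and X: "\<And>j d f u. j < h \<Longrightarrow> d \<in> demands h r D \<Longrightarrow> f \<in> {..<D} \<rightarrow> A \<Longrightarrow> u \<in> \<Omega> \<Longrightarrow> X j d f u \<in> Xs j"
    and Xs: "\<And>j. j < h \<Longrightarrow> finite (Xs j)" "\<And>j. j < h \<Longrightarrow> card (Xs j) \<le> 2 ^ nat \<lceil>R1 * F\<rceil>"
    and Y: "\<And>S j d x v. S \<in> users h r \<Longrightarrow> j \<in> S \<Longrightarrow> d \<in> demands h r D \<Longrightarrow> x \<in> Xs j \<Longrightarrow> v \<in> Vs j \<Longrightarrow>
      Y j d S x v \<in> Ys j S"
    and Ys: "\<And>S j. S \<in> users h r \<Longrightarrow> j \<in> S \<Longrightarrow> finite (Ys j S)"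
      "\<And>S j. S \<in> users h r \<Longrightarrow> j \<in> S \<Longrightarrow> card (Ys j S) \<le> 2 ^ nat \<lceil>R2 * F\<rceil>"
    and decodable: "\<And>S d f f' u u'. S \<in> users h r \<Longrightarrow> d \<in> demands h r D \<Longrightarrow>
      f \<in> {..<D} \<rightarrow> A \<Longrightarrow> f' \<in> {..<D} \<rightarrow> A \<Longrightarrow> u \<in> \<Omega> \<Longrightarrow> u' \<in> \<Omega> \<Longrightarrow> view d S f u = view d S f' u' \<Longrightarrow>
      f (d S) = f' (d S)"
    and secure: "\<And>S d f f'. S \<in> users h r \<Longrightarrow> d \<in> demands h r D \<Longrightarrow>
      f \<in> {..<D} \<rightarrow> A \<Longrightarrow> f' \<in> {..<D} \<rightarrow> A \<Longrightarrow> f (d S) = f' (d S) \<Longrightarrow>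
      map_pmf (view d S f) (pmf_of_set \<Omega>) = map_pmf (view d S f') (pmf_of_set \<Omega>)"
  shows "block_scheme h r D F M N R1 R2 \<epsilon> \<delta>"
proof -
  have relay: "j < h" if "S \<in> users h r" "j \<in> S" for S j
    using that by (auto simp: users_def)
  have "\<forall>j. \<exists>e :: 'x \<Rightarrow> bool list. (j < h \<longrightarrow> inj_on e (Xs j)) \<and> (\<forall>x. length (e x) \<le> nat \<lceil>R1 * F\<rceil>)"
  proof
    fix j show "\<exists>e :: 'x \<Rightarrow> bool list. (j < h \<longrightarrow> inj_on e (Xs j)) \<and> (\<forall>x. length (e x) \<le> nat \<lceil>R1 * F\<rceil>)"
      using ex_bit_encoder[OF Xs, of j] by (cases "j < h") (auto intro!: exI[of _ "\<lambda>_. []"])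
  qed
  from choice[OF this] obtain eX :: "nat \<Rightarrow> 'x \<Rightarrow> bool list" where
    eX: "\<And>j. j < h \<Longrightarrow> inj_on (eX j) (Xs j)" "\<And>j x. length (eX j x) \<le> nat \<lceil>R1 * F\<rceil>" by blast
  have "\<forall>j. \<exists>e :: 'v \<Rightarrow> bool list. j < h \<longrightarrow> inj_on e (Vs j)"
    using ex_bit_encoder[OF Vs(1) less_imp_le[OF less_exp]] by metis
  from choice[OF this] obtain eV :: "nat \<Rightarrow> 'v \<Rightarrow> bool list" where
    eV: "\<And>j. j < h \<Longrightarrow> inj_on (eV j) (Vs j)" by blast
  have "\<forall>S. \<exists>e :: 'z \<Rightarrow> bool list. S \<in> users h r \<longrightarrow> inj_on e (Zs S)"
    using ex_bit_encoder[OF Zs(1) less_imp_le[OF less_exp]] by metis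
  from choice[OF this] obtain eZ :: "nat set \<Rightarrow> 'z \<Rightarrow> bool list" where
    eZ: "\<And>S. S \<in> users h r \<Longrightarrow> inj_on (eZ S) (Zs S)" by blast
  have "\<forall>j S. \<exists>e :: 'y \<Rightarrow> bool list. (S \<in> users h r \<and> j \<in> S \<longrightarrow> inj_on e (Ys j S)) \<and> (\<forall>x. length (e x) \<le> nat \<lceil>R2 * F\<rceil>)"
  proof (intro allI)
    fix j S show "\<exists>e :: 'y \<Rightarrow> bool list. (S \<in> users h r \<and> j \<in> S \<longrightarrow> inj_on e (Ys j S)) \<and> (\<forall>x. length (e x) \<le> nat \<lceil>R2 * F\<rceil>)"
      using ex_bit_encoder[OF Ys, of S j]
      by (cases "S \<in> users h r \<and> j \<in> S") (auto intro!: exI[of _ "\<lambda>_. []"])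
  qed
  then obtain eY :: "nat \<Rightarrow> nat set \<Rightarrow> 'y \<Rightarrow> bool list" where
    eY: "\<And>S j. S \<in> users h r \<Longrightarrow> j \<in> S \<Longrightarrow> inj_on (eY j S) (Ys j S)"
      "\<And>S j x. length (eY j S x) \<le> nat \<lceil>R2 * F\<rceil>" by metis
  obtain g :: "'a \<Rightarrow> bool list" where g: "inj_on g A" "g ` A \<subseteq> words F"
    using card_le_inj[OF A(1) finite_words[of F]] A(3) card_words[of F] by auto
  obtain \<beta> :: "'u \<Rightarrow> nat" where \<beta>: "inj_on \<beta> \<Omega>"
    using finite_imp_inj_to_nat_seg[OF \<Omega>(1)] by auto
  \<comment> \<open>A word that encodes no symbol is treated as a default symbol: it is decoded
    wrongly, but the cache bounds and the secrecy hold for all files.\<close>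
  define e where "e w = (if w \<in> g ` A then inv_into A g w else (SOME a. a \<in> A))" for w
  have eA: "e w \<in> A" for w
    using A(2) by (auto simp: e_def inv_into_into some_in_eq)
  have ge: "g (e w) = w" if "w \<in> g ` A" for w
    using that by (simp add: e_def f_inv_into_f)
  define sy where "sy ws n = e (ws ! n)" for ws :: "bool list list" and n
  have sy: "sy ws \<in> {..<D} \<rightarrow> A" for ws by (simp add: sy_def eA)
  define \<rho> where "\<rho> = map_pmf \<beta> (pmf_of_set \<Omega>)"
  define b where "b = inv_into \<Omega> \<beta>"
  have b: "b (\<beta> u) = u" if "u \<in> \<Omega>" for u using \<beta> that by (simp add: b_def)
  have set_\<rho>: "set_pmf \<rho> = \<beta> ` \<Omega>" using \<Omega> by (simp add: \<rho>_def)
  have b\<Omega>: "b n \<in> \<Omega>" if "n \<in> set_pmf \<rho>" for n using that b by (auto simp: set_\<rho>)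
  define V' where "V' j ws n = eV j (V j (sy ws) (b n))" for j ws n
  define Z' where "Z' S ws n = eZ S (Z S (sy ws) (b n))" for S ws n
  define X' where "X' j d ws n = eX j (X j d (sy ws) (b n))" for j d ws n
  \<comment> \<open>The relay first turns its received and cached bits back into symbols.\<close>
  define Y' where "Y' j d S x v = eY j S (Y j d S (inv_into (Xs j) (eX j) x) (inv_into (Vs j) (eV j) v))"
    for j d S x v
  define bits where "bits S zy = (eZ S (fst zy), \<lambda>j. if j \<in> S then eY j S (snd zy j) else [])" for S zy
  \<comment> \<open>Picks the requested symbol of any files and randomness consistent with the
    received bits; \<open>decodable\<close> makes the outcome unique.\<close>
  define dec where "dec d S z y = g ((SOME a. \<exists>f u. f \<in> {..<D} \<rightarrow> A \<and> u \<in> \<Omega> \<and> (z, y) = bits S (view d S f u) \<and> a = f (d S)))"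
    for d S z y
  define P where "P = pair_pmf (pmf_of_set (files D F)) \<rho>"
  define rcv where "rcv = (\<lambda>d S ws u. (\<lambda>j. if j \<in> S then Y' j d S (X' j d ws u) (V' j ws u) else []))"
  have finP: "finite (set_pmf P)" using \<Omega>
    by (simp add: P_def set_\<rho> finite_files files_nonempty)
  have P: "n \<in> set_pmf \<rho>" if "(ws, n) \<in> set_pmf P" for ws n using that by (simp add: P_def)
  have received: "(Z' S ws n, rcv d S ws n) = bits S (view d S (sy ws) (b n))"
    if "S \<in> users h r" "d \<in> demands h r D" "n \<in> set_pmf \<rho>" for d S ws n
    using that relay[OF that(1)] b\<Omega>[OF that(3)]
    by (auto simp: Z'_def rcv_def bits_def view_def Y'_def X'_def V'_def fun_eq_iff
        inv_into_f_f[OF eX(1)] inv_into_f_f[OF eV] X V sy)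
  have bits_inj: "view d S f u = view d S f' u'"
    if S: "S \<in> users h r" and d: "d \<in> demands h r D" and f: "f \<in> {..<D} \<rightarrow> A" "f' \<in> {..<D} \<rightarrow> A"
      and u: "u \<in> \<Omega>" "u' \<in> \<Omega>" and eq: "bits S (view d S f u) = bits S (view d S f' u')" for d S f f' u u'
  proof -
    have "Z S f u = Z S f' u'"
      using eq inj_onD[OF eZ[OF S]] Z[OF S] f u by (simp add: bits_def view_def)
    moreover have "Y j d S (X j d f u) (V j f u) = Y j d S (X j d f' u') (V j f' u')" if j: "j \<in> S" for j
    proof -
      have "eY j S (Y j d S (X j d f u) (V j f u)) = eY j S (Y j d S (X j d f' u') (V j f' u'))"
        using fun_cong[OF conjunct2[OF eq[unfolded bits_def prod.inject]], of j] j by (simp add: view_def)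
      then show ?thesis
        using inj_onD[OF eY(1)[OF S j]] Y[OF S j d] X V relay[OF S j] d f u by blast
    qed
    ultimately show ?thesis by (auto simp: view_def fun_eq_iff)
  qed
  have decoded: "dec d S (Z' S ws n) (rcv d S ws n) = g (e (ws ! d S))"
    if prem: "S \<in> users h r" "d \<in> demands h r D" "n \<in> set_pmf \<rho>" for d S ws n
  proof -
    let ?Q = "\<lambda>a. \<exists>f u. f \<in> {..<D} \<rightarrow> A \<and> u \<in> \<Omega> \<and> (Z' S ws n, rcv d S ws n) = bits S (view d S f u) \<and> a = f (d S)"
    have "?Q (sy ws (d S))" using received[OF prem] sy b\<Omega> prem by blast
    then have "?Q (SOME a. ?Q a)" by (rule someI)
    then obtain f u where f: "f \<in> {..<D} \<rightarrow> A" "u \<in> \<Omega>"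
      "bits S (view d S (sy ws) (b n)) = bits S (view d S f u)" "(SOME a. ?Q a) = f (d S)"
      unfolding received[OF prem] by blast
    have "view d S (sy ws) (b n) = view d S f u"
      using bits_inj[OF prem(1,2) sy f(1) b\<Omega>[OF prem(3)] f(2,3)] .
    then have "sy ws (d S) = f (d S)"
      using decodable[OF prem(1,2) sy f(1) b\<Omega>[OF prem(3)] f(2)] by blast
    then show ?thesis using f(4) by (simp add: dec_def sy_def)
  qed
  have entV: "ent P (\<lambda>(ws, u). V' j ws u) \<le> N * F" if j: "j < h" for j
  proof -
    have "ent P (\<lambda>(ws, u). V' j ws u) \<le> log 2 (card (eV j ` Vs j))"
      using Vs(1)[OF j] V[OF j sy b\<Omega>] P by (intro ent_le_log_card finP) (auto simp: V'_def)
    also have "card (eV j ` Vs j) = card (Vs j)" using eV[OF j] by (rule card_image)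
    finally show ?thesis using Vs(2)[OF j] by simp
  qed
  have entZ: "ent P (\<lambda>(ws, u). Z' S ws u) \<le> M * F" if S: "S \<in> users h r" for S
  proof -
    have "ent P (\<lambda>(ws, u). Z' S ws u) \<le> log 2 (card (eZ S ` Zs S))"
      using Zs(1)[OF S] Z[OF S sy b\<Omega>] P by (intro ent_le_log_card finP) (auto simp: Z'_def)
    also have "card (eZ S ` Zs S) = card (Zs S)" using eZ[OF S] by (rule card_image)
    finally show ?thesis using Zs(2)[OF S] by simp
  qed
  have err: "measure_pmf.prob P {(ws, u). dec d S (Z' S ws u) (rcv d S ws u) \<noteq> ws ! d S} < \<epsilon>"
    if d: "d \<in> demands h r D" and S: "S \<in> users h r" for d S
  proof -
    have k: "d S < D" using d S by (simp add: demands_def)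
    have "measure_pmf.prob P {(ws, u). dec d S (Z' S ws u) (rcv d S ws u) \<noteq> ws ! d S}
        \<le> measure_pmf.prob P ((\<lambda>(ws, u). ws ! d S) -` (- (g ` A)))"
    \<comment> \<open>The inclusion holds only almost surely, since \<open>decoded\<close> speaks
      about randomness in the support of \<open>\<rho>\<close>.\<close>
    proof (rule measure_pmf.finite_measure_mono_AE)
      show "AE x in measure_pmf P. x \<in> {(ws, u). dec d S (Z' S ws u) (rcv d S ws u) \<noteq> ws ! d S} \<longrightarrow>
          x \<in> (\<lambda>(ws, u). ws ! d S) -` (- (g ` A))"
        using P decoded[OF S d] ge by (auto simp: AE_measure_pmf_iff)
    qed simp
    also have "\<dots> = measure_pmf.prob (map_pmf (\<lambda>(ws, u). ws ! d S) P) (- (g ` A))"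
      by (simp only: measure_map_pmf)
    also have "map_pmf (\<lambda>(ws, u). ws ! d S) P = map_pmf (\<lambda>ws. ws ! d S) (map_pmf fst P)"
      by (simp add: pmf.map_comp o_def case_prod_unfold)
    also have "\<dots> = pmf_of_set (words F)"
      by (simp only: P_def map_fst_pair_pmf file_uniform[OF k])
    also have "measure_pmf.prob (pmf_of_set (words F)) (- (g ` A)) = 1 - measure_pmf.prob (pmf_of_set (words F)) (g ` A)"
      using measure_pmf.prob_compl[of "g ` A" "pmf_of_set (words F)"] by (simp add: Compl_eq_Diff_UNIV)
    also have "measure_pmf.prob (pmf_of_set (words F)) (g ` A) = card A / 2 ^ F"
      using measure_pmf_of_set[OF words_nonempty finite_words, of F "g ` A"] g
      by (simp add: Int_absorb1 card_image card_words)
    finally show ?thesis using A(4) by linarith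
  qed
  have leak: "mi P (\<lambda>(ws, u). nths ws (- {d S})) (\<lambda>(ws, u). (Z' S ws u, rcv d S ws u)) < \<delta>"
    if d: "d \<in> demands h r D" and S: "S \<in> users h r" for d S
  proof -
    have k: "d S < D" using d S by (simp add: demands_def)
    \<comment> \<open>The bit view is a fixed function of the symbol view, so equality of the symbol
      laws carries over.\<close>
    have view: "map_pmf (\<lambda>u. (Z' S ws u, rcv d S ws u)) \<rho>
        = map_pmf (bits S) (map_pmf (view d S (sy ws)) (pmf_of_set \<Omega>))" for ws
    proof -
      have "map_pmf (\<lambda>u. (Z' S ws u, rcv d S ws u)) \<rho> = map_pmf (\<lambda>u. bits S (view d S (sy ws) (b u))) \<rho>"
        using received[OF S d] by (intro map_pmf_cong) auto
      also have "\<dots> = map_pmf (\<lambda>u. bits S (view d S (sy ws) u)) (pmf_of_set \<Omega>)"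
        unfolding \<rho>_def pmf.map_comp o_def using \<Omega> by (intro map_pmf_cong) (auto simp: b)
      finally show ?thesis by (simp add: pmf.map_comp o_def)
    qed
    have "mi P (\<lambda>(ws, u). nths ws (- {d S})) (\<lambda>(ws, u). (Z' S ws u, rcv d S ws u)) = 0"
      unfolding P_def
    proof (rule mi_other_files_eq_0[OF k])
      show "finite (set_pmf \<rho>)" using \<Omega> by (simp add: set_\<rho>)
      show "map_pmf (\<lambda>u. (Z' S ws u, rcv d S ws u)) \<rho> = map_pmf (\<lambda>u. (Z' S ws' u, rcv d S ws' u)) \<rho>"
        if "ws ! d S = ws' ! d S" for ws ws'
        using secure[OF S d sy sy, of ws ws'] that unfolding view by (simp add: sy_def)
    qed
    then show ?thesis using \<delta> by simp
  qed
  have len: "length (X' j d ws u) \<le> nat \<lceil>R1 * F\<rceil>" "length (Y' j d S x v) \<le> nat \<lceil>R2 * F\<rceil>" for j d S ws u x v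
    by (simp_all add: X'_def Y'_def eX eY)
  have fin: "finite (set_pmf \<rho>)" using \<Omega> by (simp add: set_\<rho>)
  show ?thesis
    unfolding block_scheme_def Let_def
    by (rule exI[of _ \<rho>], rule exI[of _ V'], rule exI[of _ Z'], rule exI[of _ X'], rule exI[of _ Y'], rule exI[of _ dec])
       (intro conjI allI ballI impI fin len entV[unfolded P_def] entZ[unfolded P_def]
         err[unfolded P_def rcv_def] leak[unfolded P_def rcv_def])
qed

section \<open>The coded scheme\<close>

text \<open>Counting by complement gives a formula that is also right at \<open>k = 0\<close>, and
  it is the form in which \<open>key_len\<close> is defined.\<close>

lemma card_subsets_containing:
  assumes "finite A" "x \<in> A"
  shows "card {B. B \<subseteq> A \<and> card B = k \<and> x \<in> B} = (card A choose k) - ((card A - 1) choose k)"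
proof -
  have "{B. B \<subseteq> A \<and> card B = k \<and> x \<in> B} = {B. B \<subseteq> A \<and> card B = k} - {B. B \<subseteq> A - {x} \<and> card B = k}"
    by auto
  also have "card \<dots> = card {B. B \<subseteq> A \<and> card B = k} - card {B. B \<subseteq> A - {x} \<and> card B = k}"
    using assms by (intro card_Diff_subset) auto
  finally show ?thesis using assms by (simp add: n_subsets)
qed

lemma card_PiE_Sigma_residues:
  fixes p :: "nat \<Rightarrow> int"
  assumes "\<And>s. s < K \<Longrightarrow> finite (I s)"
  shows "card (PiE (SIGMA s:{..<K}. I s) (\<lambda>(s, _). {0..<p s})) = (\<Prod>s<K. nat (p s) ^ card (I s))"
proof -
  have "card (PiE (SIGMA s:{..<K}. I s) (\<lambda>(s, _). {0..<p s})) = (\<Prod>(s, _)\<in>(SIGMA s:{..<K}. I s). nat (p s))"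
    using assms by (subst card_PiE) (auto intro!: prod.cong)
  also have "\<dots> = (\<Prod>s<K. \<Prod>_\<in>I s. nat (p s))" using assms by (intro prod.Sigma[symmetric]) auto
  finally show ?thesis by simp
qed

text \<open>Translation by \<open>- \<delta>\<close> is the inverse. Uniform randomness is therefore
  invariant under translations, as in a one-time pad.\<close>

lemma bij_betw_translate_residues:
  fixes m :: "'i \<Rightarrow> int"
  assumes "\<And>i. i \<in> I \<Longrightarrow> 0 < m i"
  shows "bij_betw (\<lambda>u. restrict (\<lambda>i. (u i + \<delta> i) mod m i) I) (PiE I (\<lambda>i. {0..<m i})) (PiE I (\<lambda>i. {0..<m i}))"
  by (rule bij_betw_byWitness[where f' = "\<lambda>u. restrict (\<lambda>i. (u i - \<delta> i) mod m i) I"])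
    (use assms in \<open>auto simp: mod_simps PiE_iff extensional_def fun_eq_iff\<close>)

lemma finite_users: "finite (users h r)"
  by (rule finite_subset[of _ "Pow {..<h}"]) (auto simp: users_def)

definition relay_users :: "nat \<Rightarrow> nat \<Rightarrow> nat \<Rightarrow> nat set set" where
  "relay_users h r j = {S \<in> users h r. j \<in> S}"

lemma finite_relay_users: "finite (relay_users h r j)"
  using finite_users by (simp add: relay_users_def)

lemma card_relay_users:
  assumes "0 < r" "j < h"
  shows "card (relay_users h r j) = Khat h r"
proof -
  have "relay_users h r j = {S. S \<subseteq> {..<h} \<and> card S = r \<and> j \<in> S}"
    by (auto simp: relay_users_def users_def)
  moreover obtain h' r' where "h = Suc h'" "r = Suc r'" using assms by (cases h; cases r) auto
  ultimately show ?thesis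
    using card_subsets_containing[of "{..<h}" j r] assms by (simp add: Khat_def)
qed

text \<open>Bounds the differences of evaluation points of both codes: relay indices for the
  Reed-Solomon code, numbers of sets of users for the secret sharing.\<close>

definition node_bound :: "nat \<Rightarrow> nat \<Rightarrow> nat" where
  "node_bound h r = max h (card (Pow (users h r)))"

text \<open>A file is a pair: \<open>fst w i\<close> is message symbol \<open>i < r\<close> of the part that the relays cache,
  \<open>snd w (s, i, l)\<close> is symbol \<open>l\<close> of message block \<open>i < r\<close> of the part served with the paper's
  parameter \<open>t = s\<close>. The random symbol \<open>u (s, j, n, l)\<close> protects file \<open>n\<close> at relay \<open>j\<close>.\<close>

type_synonym file_symbol = "(nat \<Rightarrow> int) \<times> (nat \<times> nat \<times> nat \<Rightarrow> int)"
type_synonym randomness = "nat \<times> nat \<times> nat \<times> nat \<Rightarrow> int"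

text \<open>The moduli may be composite: the coprimality assumptions take the place of invertibility
  of differences in a field.\<close>

locale coded_scheme =
  fixes h r D :: nat and q :: int and p :: "nat \<Rightarrow> int"
  assumes r: "0 < r" and q: "0 < q" and p: "\<And>s. 0 < p s"
    and coprime_q: "\<And>k. k \<noteq> 0 \<Longrightarrow> \<bar>k\<bar> \<le> int (node_bound h r) \<Longrightarrow> coprime q k"
    and coprime_p: "\<And>s k. k \<noteq> 0 \<Longrightarrow> \<bar>k\<bar> \<le> int (node_bound h r) \<Longrightarrow> coprime (p s) k"
begin

section \<open>Components of the scheme: shares, caches and signals\<close>

abbreviation "K \<equiv> Khat h r"

abbreviation "U j \<equiv> relay_users h r j"

definition node :: "nat set set \<Rightarrow> int" where
  "node T = int (to_nat_on (Pow (users h r)) T)"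

text \<open>For a fixed user of a relay with \<open>K\<close> users, this counts the
  \<open>s\<close>-subsets that avoid the user, equivalently the \<open>(s + 1)\<close>-subsets that
  contain it: shares still wanted and sums heard.\<close>

definition msg_len :: "nat \<Rightarrow> nat" where
  "msg_len s = (K - 1) choose s"

definition key_len :: "nat \<Rightarrow> nat" where
  "key_len s = (K choose s) - msg_len s"

definition alph :: "file_symbol set" where
  "alph = PiE {..<r} (\<lambda>_. {0..<q}) \<times> PiE (SIGMA s:{..<K}. {..<r} \<times> {..<msg_len s}) (\<lambda>(s, _). {0..<p s})"

definition \<Omega> :: "randomness set" where
  "\<Omega> = PiE (SIGMA s:{..<K}. {..<h} \<times> {..<D} \<times> {..<key_len s}) (\<lambda>(s, _). {0..<p s})"

definition rsym :: "file_symbol \<Rightarrow> nat \<Rightarrow> nat \<Rightarrow> nat \<Rightarrow> int" where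
  "rsym w s j l = pev r (\<lambda>i. snd w (s, i, l)) (int j) mod p s"

text \<open>The lowest \<open>key_len s\<close> coefficients of the sharing polynomial are random. The shares indexed by the
  sets \<open>T\<close> containing a fixed user number exactly \<open>key_len s\<close>, so by interpolation they are uniform
  whatever the file is, while all shares together determine every coefficient.\<close>

definition share :: "(nat \<Rightarrow> file_symbol) \<Rightarrow> randomness \<Rightarrow> nat \<Rightarrow> nat \<Rightarrow> nat \<Rightarrow> nat set set \<Rightarrow> int" where
  "share f u s j n T =
    pev (K choose s) (\<lambda>l. if l < key_len s then u (s, j, n, l) else rsym (f n) s j (l - key_len s)) (node T) mod p s"

text \<open>Relays store code symbols of all files in the clear; a user only ever receives the one
  of the file it requests.\<close>

definition V :: "nat \<Rightarrow> (nat \<Rightarrow> file_symbol) \<Rightarrow> randomness \<Rightarrow> nat \<Rightarrow> int" where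
  "V j f u = restrict (\<lambda>n. pev r (fst (f n)) (int j) mod q) {..<D}"

definition Zidx :: "nat set \<Rightarrow> (nat \<times> nat \<times> nat \<times> nat set set) set" where
  "Zidx S = (SIGMA s:{..<K}. SIGMA j:S. {..<D} \<times> {T. T \<subseteq> U j \<and> card T = s \<and> S \<in> T})"

definition Z :: "nat set \<Rightarrow> (nat \<Rightarrow> file_symbol) \<Rightarrow> randomness \<Rightarrow> nat \<times> nat \<times> nat \<times> nat set set \<Rightarrow> int" where
  "Z S f u = restrict (\<lambda>(s, j, n, T). share f u s j n T) (Zidx S)"

definition Xidx :: "nat \<Rightarrow> (nat \<times> nat set set) set" where
  "Xidx j = (SIGMA s:{..<K}. {T. T \<subseteq> U j \<and> card T = Suc s})"

definition X :: "nat \<Rightarrow> (nat set \<Rightarrow> nat) \<Rightarrow> (nat \<Rightarrow> file_symbol) \<Rightarrow> randomness \<Rightarrow> nat \<times> nat set set \<Rightarrow> int" where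
  "X j d f u = restrict (\<lambda>(s, T). (\<Sum>S\<in>T. share f u s j (d S) (T - {S})) mod p s) (Xidx j)"

definition Yidx :: "nat \<Rightarrow> nat set \<Rightarrow> (nat \<times> nat set set) set" where
  "Yidx j S = (SIGMA s:{..<K}. {T. T \<subseteq> U j \<and> card T = Suc s \<and> S \<in> T})"

definition Y :: "nat \<Rightarrow> (nat set \<Rightarrow> nat) \<Rightarrow> nat set \<Rightarrow> (nat \<times> nat set set \<Rightarrow> int) \<Rightarrow> (nat \<Rightarrow> int) \<Rightarrow>
    int \<times> (nat \<times> nat set set \<Rightarrow> int)" where
  "Y j d S x v = (v (d S), restrict x (Yidx j S))"

definition "Vs = PiE {..<D} (\<lambda>_. {0..<q})"
definition "Zs S = PiE (Zidx S) (\<lambda>(s, _). {0..<p s})"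
definition "Xs j = PiE (Xidx j) (\<lambda>(s, _). {0..<p s})"
definition "Ys j S = {0..<q} \<times> PiE (Yidx j S) (\<lambda>(s, _). {0..<p s})"

definition "view d S f u = (Z S f u, restrict (\<lambda>j. Y j d S (X j d f u) (V j f u)) S)"

section \<open>Shares and the coprimality of evaluation points\<close>

lemma usersD: "S \<in> users h r \<Longrightarrow> finite S \<and> card S = r \<and> S \<subseteq> {..<h}"
  by (auto simp: users_def intro: finite_subset)

lemma K_pos: "j < h \<Longrightarrow> S \<in> users h r \<Longrightarrow> j \<in> S \<Longrightarrow> 0 < K"
  using card_relay_users[OF r, of j h] finite_relay_users[of h r j]
  by (metis (mono_tags, lifting) card_gt_0_iff empty_iff mem_Collect_eq relay_users_def)

lemma msg_len_le: "msg_len s \<le> (K choose s)"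
  by (cases K; cases s) (simp_all add: msg_len_def)

lemma key_len_le: "key_len s \<le> (K choose s)" and choose_diff_key_len: "(K choose s) - key_len s = msg_len s"
  using msg_len_le[of s] by (auto simp: key_len_def)

lemma share_altdef:
  "share f u s j n T =
    (pev (key_len s) (\<lambda>l. u (s, j, n, l)) (node T) + node T ^ key_len s * pev (msg_len s) (rsym (f n) s j) (node T)) mod p s"
  unfolding share_def
  using pev_split[OF key_len_le, of s "\<lambda>l. u (s, j, n, l)" "rsym (f n) s j"] by (simp add: choose_diff_key_len)

lemma share_range: "0 \<le> share f u s j n T" "share f u s j n T < p s"
  using p[of s] by (simp_all add: share_def)

lemma node_props:
  assumes "T \<subseteq> users h r" "T' \<subseteq> users h r"
  shows "node T = node T' \<longleftrightarrow> T = T'" and "node T \<noteq> node T' \<Longrightarrow> coprime (p s) (node T - node T')"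
proof -
  have bij: "bij_betw (to_nat_on (Pow (users h r))) (Pow (users h r)) {..<card (Pow (users h r))}"
    using finite_users by (intro to_nat_on_finite) simp
  show "node T = node T' \<longleftrightarrow> T = T'"
    using inj_on_eq_iff[OF bij_betw_imp_inj_on[OF bij]] assms by (simp add: node_def)
  have "to_nat_on (Pow (users h r)) T < card (Pow (users h r))"
    "to_nat_on (Pow (users h r)) T' < card (Pow (users h r))"
    using bij_betw_apply[OF bij] assms by (metis PowI lessThan_iff)+
  then have "\<bar>node T - node T'\<bar> \<le> int (node_bound h r)"
    by (auto simp: node_def node_bound_def)
  then show "node T \<noteq> node T' \<Longrightarrow> coprime (p s) (node T - node T')"
    by (intro coprime_p) auto
qed

lemma node_inj: "\<T> \<subseteq> Pow (U j) \<Longrightarrow> inj_on node \<T>"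
  using node_props(1) by (intro inj_onI) (auto simp: relay_users_def subset_iff)

lemma node_coprime:
  assumes "\<T> \<subseteq> Pow (U j)" "x \<in> node ` \<T>" "y \<in> node ` \<T>" "x \<noteq> y"
  shows "coprime (p s) (x - y)"
proof -
  from assms obtain T T' where "x = node T" "y = node T'" "T \<subseteq> users h r" "T' \<subseteq> users h r"
    by (auto simp: relay_users_def)
  with assms(4) show ?thesis using node_props(2) by blast
qed

lemma relay_coprime:
  assumes "S \<in> users h r" "x \<in> int ` S" "y \<in> int ` S" "x \<noteq> y"
  shows "coprime q (x - y)" "coprime (p s) (x - y)"
proof -
  obtain i j where "x = int i" "y = int j" "i < h" "j < h" using assms usersD[OF assms(1)] by blast
  then have "\<bar>x - y\<bar> \<le> int (node_bound h r)" by (auto simp: node_bound_def)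
  then show "coprime q (x - y)" "coprime (p s) (x - y)" using assms(4) by (auto intro: coprime_q coprime_p)
qed

section \<open>Decoding\<close>

text \<open>The shares of a relay symbol are \<open>K choose s\<close> values at distinct nodes, as
  many as the sharing polynomial has coefficients; the message symbols sit from position
  \<open>key_len s\<close> on.\<close>

lemma rsym_eq_if_shares_eq:
  assumes j: "j < h" and l: "l < msg_len s"
    and eq: "\<And>T. T \<subseteq> U j \<Longrightarrow> card T = s \<Longrightarrow> share f u s j n T = share f' u' s j n T"
  shows "rsym (f n) s j l = rsym (f' n) s j l"
proof -
  define \<T> where "\<T> = {T. T \<subseteq> U j \<and> card T = s}"
  have \<T>: "\<T> \<subseteq> Pow (U j)" by (auto simp: \<T>_def)
  have "card \<T> = (K choose s)"
    using n_subsets[OF finite_relay_users] card_relay_users[OF r j] by (simp add: \<T>_def)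
  then have crd: "(K choose s) \<le> card (node ` \<T>)" using card_image[OF node_inj[OF \<T>]] by simp
  have fin: "finite (node ` \<T>)"
    using finite_subset[OF \<T>] finite_relay_users by auto
  let ?c = "\<lambda>f u l. if l < key_len s then u (s, j, n, l) else rsym (f n) s j (l - key_len s)"
  have peq: "[pev (K choose s) (?c f u) x = pev (K choose s) (?c f' u') x] (mod p s)" if "x \<in> node ` \<T>" for x
    using that eq by (auto simp: \<T>_def share_def cong_def)
  have "key_len s + l < (K choose s)" using l choose_diff_key_len[of s] by linarith
  from pev_inj_mod[OF fin crd node_coprime[OF \<T>] peq this]
  have "[rsym (f n) s j l = rsym (f' n) s j l] (mod p s)" by simp
  then show ?thesis by (simp add: cong_def rsym_def)
qed

text \<open>The Reed-Solomon property: the \<open>r\<close> relays of a user determine polynomials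
  with \<open>r\<close> coefficients. Entries are reduced residues, so congruence gives
  equality.\<close>

lemma symbol_eq_if_evals_eq:
  assumes S: "S \<in> users h r" and w: "w \<in> alph" "w' \<in> alph"
    and q_eq: "\<And>j. j \<in> S \<Longrightarrow> [pev r (fst w) (int j) = pev r (fst w') (int j)] (mod q)"
    and p_eq: "\<And>s j l. s < K \<Longrightarrow> j \<in> S \<Longrightarrow> l < msg_len s \<Longrightarrow> rsym w s j l = rsym w' s j l"
  shows "w = w'"
proof -
  have fin: "finite (int ` S)" and crd: "r \<le> card (int ` S)"
    using usersD[OF S] by (auto simp: card_image)
  let ?I = "SIGMA s:{..<K}. {..<r} \<times> {..<msg_len s}"
  have fw: "fst w \<in> PiE {..<r} (\<lambda>_. {0..<q})" "fst w' \<in> PiE {..<r} (\<lambda>_. {0..<q})"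
    and sw: "snd w \<in> PiE ?I (\<lambda>(s, _). {0..<p s})" "snd w' \<in> PiE ?I (\<lambda>(s, _). {0..<p s})"
    using w unfolding alph_def mem_Times_iff by blast+
  have "fst w = fst w'"
  proof (rule PiE_ext[OF fw])
    fix i assume "i \<in> {..<r}"
    then have i: "i < r" by simp
    have peq: "[pev r (fst w) x = pev r (fst w') x] (mod q)" if "x \<in> int ` S" for x
      using q_eq that by auto
    have "[fst w i = fst w' i] (mod q)"
      by (rule pev_inj_mod[OF fin crd relay_coprime(1)[OF S] peq i])
    moreover have "0 \<le> fst w i" "fst w i < q" "0 \<le> fst w' i" "fst w' i < q"
      using PiE_mem[OF fw(1), of i] PiE_mem[OF fw(2), of i] i by auto
    ultimately show "fst w i = fst w' i" by (simp add: cong_def)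
  qed
  moreover have "snd w = snd w'"
  proof (rule PiE_ext[OF sw])
    fix x assume x: "x \<in> ?I"
    then obtain s i l where x_eq: "x = (s, i, l)" and s: "s < K" and i: "i < r" and l: "l < msg_len s" by auto
    have peq: "[pev r (\<lambda>i. snd w (s, i, l)) y = pev r (\<lambda>i. snd w' (s, i, l)) y] (mod p s)" if "y \<in> int ` S" for y
      using p_eq[OF s _ l] that by (auto simp: rsym_def cong_def)
    have "[snd w (s, i, l) = snd w' (s, i, l)] (mod p s)"
      by (rule pev_inj_mod[OF fin crd relay_coprime(2)[OF S] peq i])
    moreover have "0 \<le> snd w x" "snd w x < p s" "0 \<le> snd w' x" "snd w' x < p s"
      using PiE_mem[OF sw(1) x] PiE_mem[OF sw(2) x] by (auto simp: x_eq)
    ultimately show "snd w x = snd w' x" by (simp add: cong_def x_eq)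
  qed
  ultimately show ?thesis by (rule prod_eqI)
qed

lemma view_eqD:
  assumes "view d S f u = view d S f' u'"
  shows "(s, j, n, T) \<in> Zidx S \<Longrightarrow> share f u s j n T = share f' u' s j n T"
    and "j \<in> S \<Longrightarrow> V j f u (d S) = V j f' u' (d S)"
    and "j \<in> S \<Longrightarrow> (s, T) \<in> Yidx j S \<Longrightarrow> X j d f u (s, T) = X j d f' u' (s, T)"
proof -
  have Z: "Z S f u = Z S f' u'"
    and Y: "\<And>j. j \<in> S \<Longrightarrow> Y j d S (X j d f u) (V j f u) = Y j d S (X j d f' u') (V j f' u')"
    using assms by (auto simp: view_def fun_eq_iff restrict_def split: if_splits)
  show "share f u s j n T = share f' u' s j n T" if "(s, j, n, T) \<in> Zidx S"
    using fun_cong[OF Z, of "(s, j, n, T)"] that by (simp add: Z_def)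
  show "V j f u (d S) = V j f' u' (d S)" if "j \<in> S"
    using Y[OF that] by (simp add: Y_def)
  show "X j d f u (s, T) = X j d f' u' (s, T)" if "j \<in> S" "(s, T) \<in> Yidx j S"
    using Y[OF that(1)] that(2) unfolding Y_def by (metis prod.inject restrict_apply')
qed

text \<open>Shares of sets containing \<open>S\<close> are cached and the others come out of the
  sums; all shares give the relay symbols, and \<open>r\<close> relays give the file. The two values
  \<open>u\<close> and \<open>u'\<close> are unrelated because the user does not know the
  randomness.\<close>

lemma decodable:
  assumes S: "S \<in> users h r" and d: "d \<in> demands h r D"
    and f: "f \<in> {..<D} \<rightarrow> alph" "f' \<in> {..<D} \<rightarrow> alph"
    and eq: "view d S f u = view d S f' u'"
  shows "f (d S) = f' (d S)"
proof (rule symbol_eq_if_evals_eq[OF S])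
  have dD: "d S' < D" if "S' \<in> users h r" for S' using d that by (simp add: demands_def)
  show "f (d S) \<in> alph" "f' (d S) \<in> alph" using f dD[OF S] by auto
  show "[pev r (fst (f (d S))) (int j) = pev r (fst (f' (d S))) (int j)] (mod q)" if "j \<in> S" for j
    using view_eqD(2)[OF eq that] dD[OF S] by (simp add: V_def cong_def)
  fix s j l assume s: "s < K" and j: "j \<in> S" and l: "l < msg_len s"
  have jh: "j < h" using usersD[OF S] j by auto
  have SU: "S \<in> U j" using S j by (simp add: relay_users_def)
  have "share f u s j (d S) T = share f' u' s j (d S) T" if T: "T \<subseteq> U j" "card T = s" for T
  proof (cases "S \<in> T")
    case True
    then show ?thesis using T s j dD[OF S] by (intro view_eqD(1)[OF eq]) (auto simp: Zidx_def)
  next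
    case False
    \<comment> \<open>The sum sent for \<open>T'\<close> contains the missing share of
      \<open>T\<close>, mixed with shares meant for the users in \<open>T\<close>.\<close>
    define T' where "T' = insert S T"
    have finT: "finite T" using T(1) finite_relay_users finite_subset by blast
    have T': "(s, T') \<in> Yidx j S" "(s, T') \<in> Xidx j"
      using T s SU False finT by (auto simp: Yidx_def Xidx_def T'_def)
    have sum: "X j d f u (s, T') = (share f u s j (d S) T + (\<Sum>S'\<in>T. share f u s j (d S') (T' - {S'}))) mod p s" for f u
    proof -
      have "T' - {S} = T" using False by (auto simp: T'_def)
      then have "(\<Sum>S'\<in>T'. share f u s j (d S') (T' - {S'})) =
          share f u s j (d S) T + (\<Sum>S'\<in>T. share f u s j (d S') (T' - {S'}))"
        using False finT by (simp add: T'_def)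
      then show ?thesis using T'(2) by (simp add: X_def)
    qed
    \<comment> \<open>The interfering shares belong to sets that still contain \<open>S\<close>, so
      the user has them cached and can subtract them.\<close>
    have "share f u s j (d S') (T' - {S'}) = share f' u' s j (d S') (T' - {S'})" if S': "S' \<in> T" for S'
    proof (rule view_eqD(1)[OF eq])
      have "S' \<noteq> S" using False S' by auto
      moreover have "card (T' - {S'}) = s" using S' finT False T(2) by (simp add: T'_def)
      moreover have "d S' < D" using S' T(1) by (intro dD) (auto simp: relay_users_def)
      ultimately show "(s, j, d S', T' - {S'}) \<in> Zidx S"
        using s j T(1) SU by (auto simp: Zidx_def T'_def)
    qed
    then have "(\<Sum>S'\<in>T. share f u s j (d S') (T' - {S'})) = (\<Sum>S'\<in>T. share f' u' s j (d S') (T' - {S'}))"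
      by (intro sum.cong) auto
    moreover define C where "C = (\<Sum>S'\<in>T. share f' u' s j (d S') (T' - {S'}))"
    ultimately have "[share f u s j (d S) T + C = share f' u' s j (d S) T + C] (mod p s)"
      using view_eqD(3)[OF eq j T'(1)] by (simp add: sum cong_def)
    then have "[share f u s j (d S) T = share f' u' s j (d S) T] (mod p s)"
      by (simp only: cong_add_rcancel)
    then show ?thesis by (simp add: cong_def share_def)
  qed
  then show "rsym (f (d S)) s j l = rsym (f' (d S)) s j l"
    by (rule rsym_eq_if_shares_eq[OF jh l])
qed

section \<open>Secrecy\<close>

text \<open>At relay \<open>j\<close> the user caches exactly \<open>key_len s\<close> shares of
  each file, as many as there are random coefficients, so any prescribed change of these shares is
  realised by a change of the random coefficients.\<close>

lemma ex_shift:
  assumes S: "S \<in> users h r" and j: "j \<in> S"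
  shows "\<exists>\<delta>. \<forall>T. T \<subseteq> U j \<longrightarrow> card T = s \<longrightarrow> S \<in> T \<longrightarrow> [pev (key_len s) \<delta> (node T) = y (node T)] (mod p s)"
proof -
  define \<T> where "\<T> = {T. T \<subseteq> U j \<and> card T = s \<and> S \<in> T}"
  have \<T>: "\<T> \<subseteq> Pow (U j)" by (auto simp: \<T>_def)
  have jh: "j < h" using usersD[OF S] j by auto
  have "S \<in> U j" using S j by (simp add: relay_users_def)
  then have "card \<T> = key_len s"
    using card_subsets_containing[OF finite_relay_users, of S h r j s] card_relay_users[OF r jh]
    by (simp add: \<T>_def key_len_def msg_len_def)
  then have crd: "card (node ` \<T>) = key_len s" using card_image[OF node_inj[OF \<T>]] by simp
  have fin: "finite (node ` \<T>)"
    using finite_subset[OF \<T>] finite_relay_users by auto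
  obtain \<delta> where "\<forall>x\<in>node ` \<T>. [pev (key_len s) \<delta> x = y x] (mod p s)"
    using pev_surj_mod[OF fin crd p node_coprime[OF \<T>]] by blast
  then show ?thesis by (auto simp: \<T>_def)
qed

lemma finite_\<Omega>: "finite \<Omega>"
  unfolding \<Omega>_def by (intro finite_PiE finite_SigmaI) auto

lemma \<Omega>_nonempty: "\<Omega> \<noteq> {}"
  using p by (auto simp: \<Omega>_def PiE_eq_empty_iff not_less)

text \<open>A translation \<open>\<phi>\<close> of the randomness makes the view of
  \<open>\<phi> u\<close> under \<open>f'\<close> equal to the view of \<open>u\<close> under
  \<open>f\<close>; as \<open>\<phi>\<close> permutes \<open>\<Omega>\<close>, both laws
  agree.\<close>

lemma secure:
  assumes S: "S \<in> users h r" and d: "d \<in> demands h r D" and eq: "f (d S) = f' (d S)"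
  shows "map_pmf (view d S f) (pmf_of_set \<Omega>) = map_pmf (view d S f') (pmf_of_set \<Omega>)"
proof -
  have dD: "d S' < D" if "S' \<in> users h r" for S' using d that by (simp add: demands_def)
  \<comment> \<open>The difference of the message parts of a share under \<open>f\<close> and
    \<open>f'\<close>, which the shifted random coefficients have to make up for.\<close>
  define y where "y s j n x = x ^ key_len s * (pev (msg_len s) (rsym (f n) s j) x - pev (msg_len s) (rsym (f' n) s j) x)" for s j n x
  \<comment> \<open>For an unchanged file the whole shift must vanish, not just its values at the
    cached nodes: of its own file the user also learns shares of sets without
    \<open>S\<close>.\<close>
  define good where "good s j n \<delta> \<longleftrightarrow> (f n = f' n \<longrightarrow> \<delta> = (\<lambda>_. 0)) \<and> (j \<in> S \<longrightarrow>
      (\<forall>T. T \<subseteq> U j \<longrightarrow> card T = s \<longrightarrow> S \<in> T \<longrightarrow> [pev (key_len s) \<delta> (node T) = y s j n (node T)] (mod p s)))" for s j n \<delta>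
  define \<delta> where "\<delta> s j n = (SOME \<delta>. good s j n \<delta>)" for s j n
  have "\<exists>\<delta>. good s j n \<delta>" for s j n
  proof (cases "f n = f' n")
    case True
    then show ?thesis by (intro exI[of _ "\<lambda>_. 0"]) (simp add: good_def y_def pev_def)
  next
    case False
    then show ?thesis using ex_shift[OF S, of j s "y s j n"] unfolding good_def by blast
  qed
  then have good: "good s j n (\<delta> s j n)" for s j n unfolding \<delta>_def by (rule someI_ex)
  have \<delta>0: "\<delta> s j n = (\<lambda>_. 0)" if "f n = f' n" for s j n
    using good[of s j n] that by (simp add: good_def)
  have \<delta>: "[pev (key_len s) (\<delta> s j n) (node T) = y s j n (node T)] (mod p s)"
    if "j \<in> S" "T \<subseteq> U j" "card T = s" "S \<in> T" for s j n T
    using good[of s j n] that by (simp add: good_def)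
  define I where "I = (SIGMA s:{..<K}. {..<h} \<times> {..<D} \<times> {..<key_len s})"
  define \<phi> where "\<phi> u = restrict (\<lambda>i. (u i + (case i of (s, j, n, l) \<Rightarrow> \<delta> s j n l)) mod p (fst i)) I" for u
  have "\<Omega> = PiE I (\<lambda>i. {0..<p (fst i)})" by (simp add: \<Omega>_def I_def case_prod_unfold)
  then have bij: "bij_betw \<phi> \<Omega> \<Omega>"
    using bij_betw_translate_residues[of I "\<lambda>i. p (fst i)"] p unfolding \<phi>_def by auto
  have pev_\<phi>: "[pev (key_len s) (\<lambda>l. \<phi> u (s, j, n, l)) x = pev (key_len s) (\<lambda>l. u (s, j, n, l)) x + pev (key_len s) (\<delta> s j n) x] (mod p s)"
    if "s < K" "j < h" "n < D" for s j n x u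
  proof -
    have "pev (key_len s) (\<lambda>l. u (s, j, n, l)) x + pev (key_len s) (\<delta> s j n) x = pev (key_len s) (\<lambda>l. u (s, j, n, l) + \<delta> s j n l) x"
      by (simp add: pev_def sum.distrib algebra_simps)
    moreover have "[pev (key_len s) (\<lambda>l. \<phi> u (s, j, n, l)) x = pev (key_len s) (\<lambda>l. u (s, j, n, l) + \<delta> s j n l) x] (mod p s)"
      unfolding pev_def using that
      by (intro cong_sum cong_mult cong_refl) (auto simp: \<phi>_def I_def cong_def)
    ultimately show ?thesis by simp
  qed
  have share_eq: "share f u s j n T = share f' (\<phi> u) s j n T"
    if s: "s < K" and j: "j \<in> S" and n: "n < D" and T: "T \<subseteq> U j" "card T = s" and *: "S \<in> T \<or> f n = f' n"
    for u s j n T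
  proof -
    have jh: "j < h" using usersD[OF S] j by auto
    have \<delta>y: "[pev (key_len s) (\<delta> s j n) (node T) = y s j n (node T)] (mod p s)"
    proof (cases "f n = f' n")
      case True
      then show ?thesis by (simp add: \<delta>0 y_def pev_def)
    next
      case False
      then show ?thesis using \<delta>[OF j T] * by simp
    qed
    let ?x = "node T"
    have "[pev (key_len s) (\<lambda>l. \<phi> u (s, j, n, l)) ?x + ?x ^ key_len s * pev (msg_len s) (rsym (f' n) s j) ?x
        = (pev (key_len s) (\<lambda>l. u (s, j, n, l)) ?x + y s j n ?x) + ?x ^ key_len s * pev (msg_len s) (rsym (f' n) s j) ?x] (mod p s)"
      by (intro cong_add cong_refl cong_trans[OF pev_\<phi>[OF s jh n]] \<delta>y)
    also have "(pev (key_len s) (\<lambda>l. u (s, j, n, l)) ?x + y s j n ?x) + ?x ^ key_len s * pev (msg_len s) (rsym (f' n) s j) ?x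
        = pev (key_len s) (\<lambda>l. u (s, j, n, l)) ?x + ?x ^ key_len s * pev (msg_len s) (rsym (f n) s j) ?x"
      by (simp add: y_def algebra_simps)
    finally show ?thesis by (simp add: share_altdef cong_def)
  qed
  have view_eq: "view d S f u = view d S f' (\<phi> u)" for u
  proof -
    have "Z S f u = Z S f' (\<phi> u)"
      unfolding Z_def by (intro restrict_ext) (auto simp: Zidx_def intro!: share_eq)
    moreover have "Y j d S (X j d f u) (V j f u) = Y j d S (X j d f' (\<phi> u)) (V j f' (\<phi> u))" if j: "j \<in> S" for j
    proof -
      have "V j f u (d S) = V j f' (\<phi> u) (d S)" by (simp add: V_def eq)
      moreover have "X j d f u (s, T) = X j d f' (\<phi> u) (s, T)" if "(s, T) \<in> Yidx j S" for s T
      proof -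
        have T: "s < K" "T \<subseteq> U j" "card T = Suc s" "S \<in> T" "(s, T) \<in> Xidx j"
          using that by (auto simp: Yidx_def Xidx_def)
        have finT: "finite T" using T(2) finite_relay_users finite_subset by blast
        \<comment> \<open>The summand \<open>S' = S\<close> belongs to the requested file, and every
          other one to a set that contains \<open>S\<close>; \<open>share_eq\<close> covers both
          cases.\<close>
        have "share f u s j (d S') (T - {S'}) = share f' (\<phi> u) s j (d S') (T - {S'})" if S': "S' \<in> T" for S'
        proof (rule share_eq[OF T(1) j])
          show "d S' < D" using S' T(2) by (intro dD) (auto simp: relay_users_def)
          show "card (T - {S'}) = s" using S' finT T(3) by simp
          show "S \<in> T - {S'} \<or> f (d S') = f' (d S')" using T(4) eq by auto
        qed (use T(2) in auto)
        then show ?thesis using T(5) by (simp add: X_def)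
      qed
      ultimately show ?thesis by (auto simp: Y_def intro!: restrict_ext)
    qed
    ultimately show ?thesis by (auto simp: view_def intro!: restrict_ext)
  qed
  have "map_pmf (view d S f) (pmf_of_set \<Omega>) = map_pmf (view d S f') (map_pmf \<phi> (pmf_of_set \<Omega>))"
    by (simp add: pmf.map_comp o_def view_eq[abs_def])
  then show ?thesis
    by (simp add: map_pmf_of_set_bij_betw[OF bij \<Omega>_nonempty finite_\<Omega>])
qed

section \<open>Alphabets of the signals and their sizes\<close>

lemma V_in: "V j f u \<in> Vs"
  using q by (auto simp: V_def Vs_def)

lemma Z_in: "Z S f u \<in> Zs S"
  using p by (auto simp: Z_def Zs_def share_range)

lemma X_in: "X j d f u \<in> Xs j"
  using p by (auto simp: X_def Xs_def)

lemma Y_in: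
  assumes "S \<in> users h r" "d \<in> demands h r D" "x \<in> Xs j" "v \<in> Vs"
  shows "Y j d S x v \<in> Ys j S"
proof -
  have "d S < D" using assms by (simp add: demands_def)
  then have "v (d S) \<in> {0..<q}" using PiE_mem[OF assms(4)[unfolded Vs_def], of "d S"] by simp
  moreover have "restrict x (Yidx j S) \<in> PiE (Yidx j S) (\<lambda>(s, _). {0..<p s})"
  proof (rule restrict_PiE_iff[THEN iffD2], rule ballI)
    fix i assume "i \<in> Yidx j S"
    then have "i \<in> Xidx j" unfolding Yidx_def Xidx_def by blast
    then show "x i \<in> (case i of (s, _) \<Rightarrow> {0..<p s})" by (rule PiE_mem[OF assms(3)[unfolded Xs_def]])
  qed
  ultimately show ?thesis by (simp add: Y_def Ys_def)
qed

lemma finite_subsets_of_relay_users: "finite {T. T \<subseteq> U j \<and> Q T}"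
  by (rule finite_subset[of _ "Pow (U j)"]) (auto simp: finite_relay_users)

lemma finite_alph: "finite alph"
  and card_alph: "card alph = nat q ^ r * (\<Prod>s<K. nat (p s) ^ (r * msg_len s))"
proof -
  show "finite alph" unfolding alph_def by (intro finite_cartesian_product finite_PiE finite_SigmaI) auto
  show "card alph = nat q ^ r * (\<Prod>s<K. nat (p s) ^ (r * msg_len s))"
    unfolding alph_def card_cartesian_product
    by (subst card_PiE_Sigma_residues) (simp_all add: card_PiE card_cartesian_product)
qed

lemma alph_nonempty: "alph \<noteq> {}"
proof -
  have "card alph > 0" using q p by (simp add: card_alph prod_pos)
  then show ?thesis by auto
qed

lemma finite_Vs: "finite Vs" and card_Vs: "card Vs = nat q ^ D"
  by (auto simp: Vs_def card_PiE intro: finite_PiE)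

lemma finite_Zs: "S \<in> users h r \<Longrightarrow> finite (Zs S)"
  and card_Zs: "S \<in> users h r \<Longrightarrow> card (Zs S) = (\<Prod>s<K. nat (p s) ^ (r * D * key_len s))"
proof -
  assume S: "S \<in> users h r"
  define I where "I s = (SIGMA j:S. {..<D} \<times> {T. T \<subseteq> U j \<and> card T = s \<and> S \<in> T})" for s
  have fin: "finite (I s)" for s
    using usersD[OF S] finite_subsets_of_relay_users unfolding I_def by auto
  have "card (I s) = r * D * key_len s" for s
  proof -
    have "card ({..<D} \<times> {T. T \<subseteq> U j \<and> card T = s \<and> S \<in> T}) = D * key_len s" if j: "j \<in> S" for j
    proof -
      have "j < h" using usersD[OF S] j by auto
      then show ?thesis
        using card_subsets_containing[OF finite_relay_users, of S h r j s] card_relay_users[OF r, of j h] S j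
        by (simp add: card_cartesian_product key_len_def msg_len_def relay_users_def)
    qed
    note * = this
    have "card (I s) = (\<Sum>j\<in>S. card ({..<D} \<times> {T. T \<subseteq> U j \<and> card T = s \<and> S \<in> T}))"
      unfolding I_def by (rule card_SigmaI) (use usersD[OF S] finite_subsets_of_relay_users in auto)
    also have "\<dots> = (\<Sum>j\<in>S. D * key_len s)" by (intro sum.cong refl *)
    finally show ?thesis using usersD[OF S] by simp
  qed
  moreover have Zs: "Zs S = PiE (SIGMA s:{..<K}. I s) (\<lambda>(s, _). {0..<p s})"
    by (simp add: Zs_def Zidx_def I_def)
  ultimately show "card (Zs S) = (\<Prod>s<K. nat (p s) ^ (r * D * key_len s))"
    by (simp add: card_PiE_Sigma_residues fin)
  show "finite (Zs S)" unfolding Zs by (intro finite_PiE finite_SigmaI fin) auto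
qed

lemma finite_Xs: "finite (Xs j)"
  and card_Xs: "j < h \<Longrightarrow> card (Xs j) = (\<Prod>s<K. nat (p s) ^ (K choose Suc s))"
proof -
  show "finite (Xs j)"
    unfolding Xs_def Xidx_def by (intro finite_PiE finite_SigmaI finite_subsets_of_relay_users) auto
  show "card (Xs j) = (\<Prod>s<K. nat (p s) ^ (K choose Suc s))" if "j < h"
    unfolding Xs_def Xidx_def
    by (simp add: card_PiE_Sigma_residues finite_subsets_of_relay_users n_subsets finite_relay_users card_relay_users[OF r that])
qed

lemma finite_Ys: "finite (Ys j S)"
  and card_Ys: "S \<in> users h r \<Longrightarrow> j \<in> S \<Longrightarrow> card (Ys j S) = nat q * (\<Prod>s<K. nat (p s) ^ msg_len s)"
proof -
  show "finite (Ys j S)"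
    unfolding Ys_def Yidx_def
    by (intro finite_cartesian_product finite_PiE finite_SigmaI finite_subsets_of_relay_users) auto
  assume S: "S \<in> users h r" and j: "j \<in> S"
  have jh: "j < h" using usersD[OF S] j by auto
  \<comment> \<open>With \<open>K\<close> a successor, Pascal's rule turns the difference of
    binomials into \<open>msg_len s\<close>.\<close>
  obtain K' where K': "K = Suc K'" using K_pos[OF jh S j] gr0_conv_Suc by auto
  have "card {T. T \<subseteq> U j \<and> card T = Suc s \<and> S \<in> T} = msg_len s" for s
    using card_subsets_containing[OF finite_relay_users, of S h r j "Suc s"] card_relay_users[OF r jh] S j K'
    by (simp add: msg_len_def relay_users_def)
  then show "card (Ys j S) = nat q * (\<Prod>s<K. nat (p s) ^ msg_len s)"
    by (simp add: Ys_def Yidx_def card_cartesian_product card_PiE_Sigma_residues finite_subsets_of_relay_users)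
qed

end

section \<open>Rates and time sharing\<close>

text \<open>The largest integer up to \<open>2 powr x\<close> that is \<open>1\<close> modulo \<open>m\<close> (for \<open>0 \<le> x\<close>, \<open>0 < m\<close>); with \<open>m\<close> a factorial it is coprime
  to all differences of evaluation points.\<close>

definition residue_floor :: "int \<Rightarrow> real \<Rightarrow> int" where
  "residue_floor m x = (\<lfloor>2 powr x\<rfloor> - 1) div m * m + 1"

lemma residue_floor_cong: "[residue_floor m x = 1] (mod m)"
  by (simp add: residue_floor_def cong_iff_dvd_diff)

text \<open>The rounding loss is at most \<open>m + 1\<close>, independently of
  \<open>x\<close>.\<close>

lemma residue_floor_bounds:
  assumes "0 < m" "0 \<le> x"
  shows "0 < residue_floor m x" "real_of_int (residue_floor m x) \<le> 2 powr x"
    "2 powr x - (m + 1) \<le> real_of_int (residue_floor m x)"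
proof -
  define y where "y = \<lfloor>2 powr x\<rfloor>"
  have "1 \<le> 2 powr x" using assms(2) by (simp add: ge_one_powr_ge_zero)
  then have y: "1 \<le> y" by (simp add: y_def)
  have eq: "residue_floor m x = y - (y - 1) mod m"
    by (simp add: residue_floor_def y_def minus_mod_eq_div_mult[symmetric])
  have "0 \<le> (y - 1) div m" using y assms(1) by (simp add: pos_imp_zdiv_nonneg_iff)
  then show "0 < residue_floor m x"
    using assms(1) by (simp add: residue_floor_def y_def[symmetric] add_nonneg_pos)
  have b: "0 \<le> (y - 1) mod m" "(y - 1) mod m < m" using assms(1) by simp_all
  have fl: "real_of_int y \<le> 2 powr x" "2 powr x < real_of_int y + 1"
    unfolding y_def by linarith+
  show "real_of_int (residue_floor m x) \<le> 2 powr x"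
    using b(1) fl(1) by (simp add: eq)
  have "y - m \<le> residue_floor m x" using b(2) by (simp add: eq)
  then have "real_of_int y - real_of_int m \<le> real_of_int (residue_floor m x)" by linarith
  then show "2 powr x - (m + 1) \<le> real_of_int (residue_floor m x)" using fl(2) by linarith
qed

text \<open>The bounded loss is negligible against the exponential growth when \<open>e\<close> is
  positive.\<close>

lemma residue_floor_asymp:
  fixes e :: real
  assumes m: "0 < m" and e: "0 \<le> e"
  shows "(\<lambda>n::nat. residue_floor m (e * n) / 2 powr (e * n)) \<longlonglongrightarrow> 1"
proof (cases "e = 0")
  \<comment> \<open>Nothing grows here, but the rounded value of \<open>2 powr 0\<close> is exactly
    1.\<close>
  case True
  then show ?thesis by (simp add: residue_floor_def)
next
  case False
  with e have e: "0 < e" by simp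
  have lower: "(\<lambda>n::nat. 1 - (m + 1) / 2 powr (e * n)) \<longlonglongrightarrow> 1 - 0"
  proof (intro tendsto_intros)
    have "1 < 2 powr e" using powr_less_mono[of 0 e 2] e by simp
    then have "(\<lambda>n::nat. (m + 1) * (1 / 2 powr e) ^ n) \<longlonglongrightarrow> real_of_int (m + 1) * 0"
      by (intro tendsto_intros LIMSEQ_realpow_zero) auto
    then show "(\<lambda>n::nat. (m + 1) / 2 powr (e * n)) \<longlonglongrightarrow> 0"
      by (simp add: powr_powr[symmetric] powr_realpow power_divide)
  qed
  have "0 \<le> e * real n" for n using e by simp
  note bounds = residue_floor_bounds[OF m this]
  have "1 - (m + 1) / 2 powr (e * n) \<le> residue_floor m (e * n) / 2 powr (e * n)" for n :: nat
    using divide_right_mono[OF bounds(3)[of n], of "2 powr (e * n)"] by (simp add: diff_divide_distrib)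
  then have lb: "\<forall>\<^sub>F n :: nat in sequentially. 1 - (m + 1) / 2 powr (e * n) \<le> residue_floor m (e * n) / 2 powr (e * n)"
    by (intro always_eventually allI)
  have "residue_floor m (e * n) / 2 powr (e * n) \<le> 1" for n :: nat
    using bounds(2)[of n] by simp
  then have ub: "\<forall>\<^sub>F n :: nat in sequentially. residue_floor m (e * n) / 2 powr (e * n) \<le> 1"
    by (intro always_eventually allI)
  show ?thesis by (rule tendsto_sandwich[OF lb ub lower[unfolded diff_zero] tendsto_const])
qed

lemma card_le_power_ceiling:
  assumes "real n \<le> 2 powr x"
  shows "n \<le> 2 ^ nat \<lceil>x\<rceil>"
proof -
  have "2 powr x \<le> 2 powr real (nat \<lceil>x\<rceil>)" by (intro powr_mono) linarith+
  then have "real n \<le> 2 powr real (nat \<lceil>x\<rceil>)" using assms by linarith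
  then show ?thesis by (simp add: powr_realpow)
qed

lemma prod_powr_power: "(\<Prod>s<K. (2 powr x s) ^ k s) = 2 powr (\<Sum>s<K. real (k s) * x s)" for x :: "nat \<Rightarrow> real"
  by (simp add: powr_sum powr_power mult.commute)

lemma prod_power_le_powr:
  fixes p :: "nat \<Rightarrow> int"
  assumes "\<And>s. s < K \<Longrightarrow> 0 < p s" "\<And>s. s < K \<Longrightarrow> real_of_int (p s) \<le> 2 powr x s"
  shows "real (\<Prod>s<K. nat (p s) ^ k s) \<le> 2 powr (\<Sum>s<K. real (k s) * x s)"
proof -
  have "real (\<Prod>s<K. nat (p s) ^ k s) = (\<Prod>s<K. real_of_int (p s) ^ k s)"
    unfolding of_nat_prod using assms(1) by (intro prod.cong) (auto simp: less_imp_le)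
  also have "\<dots> \<le> (\<Prod>s<K. (2 powr x s) ^ k s)"
    using assms by (intro prod_mono conjI power_mono zero_le_power) (auto simp: less_imp_le)
  finally show ?thesis by (simp add: prod_powr_power)
qed

text \<open>After inserting \<open>Mc\<close>, numerator and denominator share the factor
  \<open>D * \<kappa> * K / (K - s)\<close>, which cancels.\<close>

lemma R1c_eq:
  assumes "0 < r" "0 < D" "s < Khat h r"
  shows "R1c h r D N s = (1 - N * r / D) * Khat h r / (real r * (real s + 1))"
\<comment> \<open>Here the quotient in \<open>R1c\<close> degenerates to \<open>0 / 0\<close>, but
  its trailing factor makes both sides 0.\<close>
proof (cases "1 - N * r / D = 0")
  case True
  then show ?thesis unfolding R1c_def Let_def by (simp only: mult_zero_right mult_zero_left div_0)
next
  case False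
  define \<kappa> where "\<kappa> = 1 - N * r / D"
  define K where "K = real (Khat h r)"
  have K: "real s < K" using assms(3) by (simp add: K_def)
  have DN: "real D - real r * N = D * \<kappa>" using assms(2) by (simp add: \<kappa>_def field_simps)
  have M: "Mc h r D N s = s * D * \<kappa> / (K - s)" by (simp add: Mc_def \<kappa>_def K_def)
  have \<kappa>: "\<kappa> \<noteq> 0" using False by (simp add: \<kappa>_def)
  have 1: "real D + Mc h r D N s - real r * N = D * \<kappa> * K / (K - s)"
  proof -
    have "real D + Mc h r D N s - real r * N = D * \<kappa> + Mc h r D N s" using DN by linarith
    then show ?thesis using K by (simp add: M field_simps)
  qed
  have 2: "(K + 1) * Mc h r D N s + real D - real r * N = D * \<kappa> * K * (real s + 1) / (K - s)"
  proof -
    have "(K + 1) * Mc h r D N s + real D - real r * N = (K + 1) * Mc h r D N s + D * \<kappa>" using DN by linarith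
    then show ?thesis using K by (simp add: M field_simps)
  qed
  have ratio: "K * (x * K / l) / (y * (x * K * w / l)) * \<kappa> = \<kappa> * K / (y * w)"
    if "K \<noteq> 0" "x \<noteq> 0" "l \<noteq> 0" for x y w l using that by (simp add: field_simps)
  have "K * (D * \<kappa> * K / (K - s)) / (r * (D * \<kappa> * K * (real s + 1) / (K - s))) * \<kappa> = \<kappa> * K / (real r * (real s + 1))"
    using K \<kappa> assms(2) by (intro ratio) auto
  then show ?thesis
    unfolding R1c_def Let_def K_def[symmetric] \<kappa>_def[symmetric] 1 2 .
qed

text \<open>By absorption. The ratio of random to message coefficients is thus
  \<open>s / (K - s)\<close>, the factor in \<open>Mc\<close>.\<close>

lemma real_binomial_diff:
  assumes "s < K"
  shows "real ((K choose s) - ((K - 1) choose s)) * (real K - real s) = real s * real ((K - 1) choose s)"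
proof -
  have le: "((K - 1) choose s) \<le> (K choose s)" using assms by (cases K; cases s) simp_all
  have "real ((K - s) * (K choose s)) = real (K * ((K - 1) choose s))"
    by (simp only: binomial_absorb_comp)
  then have "(real K - real s) * real (K choose s) = real K * real ((K - 1) choose s)"
    using assms by (simp add: of_nat_diff)
  then show ?thesis using le by (simp add: of_nat_diff algebra_simps)
qed

text \<open>Time sharing happens within one block: part \<open>s\<close> takes the fraction
  \<open>\<tau> s * \<kappa>\<close> of each file and has its own modulus, so the sizes in bits add
  up with weights \<open>\<tau> s\<close>.\<close>

lemma time_shared_secure_achievable:
  fixes h r D :: nat and N :: real and \<tau> :: "nat \<Rightarrow> real"
  assumes r: "0 < r" "r < h" and D: "0 < D" and N: "0 \<le> N" "N \<le> D / r"
    and \<tau>: "\<And>s. s < Khat h r \<Longrightarrow> 0 \<le> \<tau> s" "(\<Sum>s<Khat h r. \<tau> s) = 1"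
  shows "secure_achievable h r D (\<Sum>s<Khat h r. \<tau> s * Mc h r D N s) N (\<Sum>s<Khat h r. \<tau> s * R1c h r D N s) (1 / r)"
  unfolding secure_achievable_iff
proof (intro allI impI)
  fix \<epsilon> \<delta> :: real assume \<epsilon>: "0 < \<epsilon>" and \<delta>: "0 < \<delta>"
  define K where "K = Khat h r"
  define c where "c s = ((K - 1) choose s)" for s
  define a where "a s = (K choose s) - c s" for s
  define \<kappa> where "\<kappa> = 1 - N * r / D"
  \<comment> \<open>Ideal bits per symbol and per bit of file: the \<open>c s\<close> message
    symbols of a relay then take the fraction \<open>\<tau> s * \<kappa> / r\<close>. The value 0
    beyond \<open>K\<close> gives modulus 1.\<close>
  define e where "e s = (if s < K then \<tau> s * \<kappa> / (r * c s) else 0)" for s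
  define m :: int where "m = fact (node_bound h r)"
  \<comment> \<open>Moduli are rounded down: the cache bounds contain no ceiling that could absorb
    an excess, and the file symbols must fit into \<open>F\<close> bits.\<close>
  define q where "q F = residue_floor m (N / D * F)" for F :: nat
  define p where "p F s = residue_floor m (e s * F)" for F :: nat and s
  have m: "0 < m" by (simp add: m_def)
  have \<kappa>: "0 \<le> \<kappa>" using N r D by (simp add: \<kappa>_def field_simps)
  have c: "0 < c s" if "s < K" for s using that by (simp add: c_def)
  have e: "0 \<le> e s" for s using \<tau>(1) \<kappa> by (auto simp: e_def K_def)
  have N0: "0 \<le> N / D * real F" for F using N by simp
  have e0: "0 \<le> e s * real F" for s F using e by simp
  have q_bounds: "0 < q F" "real_of_int (q F) \<le> 2 powr (N / D * F)" for F
    using residue_floor_bounds[OF m N0] by (simp_all add: q_def)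
  have p_bounds: "0 < p F s" "real_of_int (p F s) \<le> 2 powr (e s * F)" for F s
    using residue_floor_bounds[OF m e0] by (simp_all add: p_def)
  have ce: "real (c s) * (e s * x) = \<tau> s * \<kappa> / r * x" if "s < K" for s x
    using c[OF that] that by (simp add: e_def)
  have sum_ce: "(\<Sum>s<K. real (c s) * (e s * x)) = \<kappa> / r * x" for x
  proof -
    have "(\<Sum>s<K. real (c s) * (e s * x)) = (\<Sum>s<K. \<tau> s * (\<kappa> / r * x))"
      by (intro sum.cong refl) (simp add: ce)
    also have "\<dots> = \<kappa> / r * x" using \<tau>(2) by (simp only: sum_distrib_right[symmetric] K_def mult_1)
    finally show ?thesis .
  qed
  \<comment> \<open>At ideal sizes, \<open>r\<close> relay symbols of each kind make up exactly one
    file.\<close>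
  have total: "r * (N / D * x) + r * (\<kappa> / r * x) = x" for x
    using r D by (simp add: \<kappa>_def field_simps)
  have sum_rce: "(\<Sum>s<K. real (r * c s) * (e s * x)) = r * (\<kappa> / r * x)" for x
    unfolding sum_ce[symmetric] by (simp add: sum_distrib_left mult.assoc)
  have full: "(2 powr (N / D * F)) ^ r * (\<Prod>s<K. (2 powr (e s * F)) ^ (r * c s)) = 2 ^ F" for F :: nat
  proof -
    have "(2 powr (N / D * F)) ^ r = 2 powr (r * (N / D * F))"
      by (simp add: powr_power mult.commute)
    then have "(2 powr (N / D * F)) ^ r * (\<Prod>s<K. (2 powr (e s * F)) ^ (r * c s)) = 2 powr real F"
      by (simp only: prod_powr_power sum_rce powr_add[symmetric] total)
    then show ?thesis by (simp add: powr_realpow)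
  qed
  define sz where "sz F = nat (q F) ^ r * (\<Prod>s<K. nat (p F s) ^ (r * c s))" for F
  have sz_real: "real (sz F) = real_of_int (q F) ^ r * (\<Prod>s<K. real_of_int (p F s) ^ (r * c s))" for F
    using q_bounds(1)[of F] p_bounds(1)[of F] by (simp add: sz_def of_nat_prod less_imp_le)
  \<comment> \<open>A fixed number of ratios of rounded to ideal alphabet size, each tending to 1.
    Their product is the fraction of words that encode a file symbol.\<close>
  have "(\<lambda>F. (q F / 2 powr (N / D * F)) ^ r * (\<Prod>s<K. (p F s / 2 powr (e s * F)) ^ (r * c s)))
      \<longlonglongrightarrow> 1 ^ r * (\<Prod>s<K. 1 ^ (r * c s))"
    unfolding q_def p_def using N e
    by (intro tendsto_mult tendsto_prod tendsto_power residue_floor_asymp m) auto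
  also have "(\<lambda>F. (q F / 2 powr (N / D * F)) ^ r * (\<Prod>s<K. (p F s / 2 powr (e s * F)) ^ (r * c s)))
      = (\<lambda>F. sz F / 2 ^ F)"
    unfolding full[symmetric] by (rule ext) (simp add: sz_real power_divide prod_dividef)
  finally have "(\<lambda>F. sz F / 2 ^ F) \<longlonglongrightarrow> 1" by simp
  then have "\<forall>\<^sub>F F in sequentially. 1 - \<epsilon> < sz F / 2 ^ F" using \<epsilon> by (intro order_tendstoD) auto
  then obtain F0 where F0: "\<And>F. F \<ge> F0 \<Longrightarrow> 1 - sz F / 2 ^ F < \<epsilon>"
    unfolding eventually_sequentially by (metis diff_less_eq add.commute less_diff_eq)
  have sz_le: "sz F \<le> 2 ^ F" for F
  proof -
    have "real (sz F) \<le> (2 powr (N / D * F)) ^ r * (\<Prod>s<K. (2 powr (e s * F)) ^ (r * c s))"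
      unfolding sz_real using q_bounds[of F] p_bounds[of F]
      by (intro mult_mono prod_mono conjI power_mono zero_le_power prod_nonneg ballI) (auto simp: less_imp_le)
    then show ?thesis unfolding full by simp
  qed
  show "\<exists>F0. \<forall>F\<ge>F0. block_scheme h r D F (\<Sum>s<Khat h r. \<tau> s * Mc h r D N s) N
      (\<Sum>s<Khat h r. \<tau> s * R1c h r D N s) (1 / r) \<epsilon> \<delta>"
  proof (rule exI[of _ F0], intro allI impI)
    fix F assume F: "F0 \<le> F"
    have cop: "coprime (residue_floor m x) k" if "k \<noteq> 0" "\<bar>k\<bar> \<le> int (node_bound h r)" for k x
      using coprime_if_cong_1_mod_fact[OF residue_floor_cong[of m x, unfolded m_def] that] by (simp add: m_def)
    interpret S: coded_scheme h r D "q F" "p F"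
    proof
      show "coprime (q F) k" if "k \<noteq> 0" "\<bar>k\<bar> \<le> int (node_bound h r)" for k
        unfolding q_def using that by (rule cop)
      show "coprime (p F s) k" if "k \<noteq> 0" "\<bar>k\<bar> \<le> int (node_bound h r)" for k s
        unfolding p_def using that by (rule cop)
    qed (use r q_bounds p_bounds in auto)
    have Sc: "S.msg_len = c" by (simp add: fun_eq_iff c_def S.msg_len_def K_def)
    have Sa: "S.key_len = a" by (simp add: fun_eq_iff a_def S.key_len_def K_def Sc)
    have card_alph: "card S.alph = sz F" by (simp add: S.card_alph Sc sz_def K_def)
    show "block_scheme h r D F (\<Sum>s<Khat h r. \<tau> s * Mc h r D N s) N
        (\<Sum>s<Khat h r. \<tau> s * R1c h r D N s) (1 / r) \<epsilon> \<delta>"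
    proof (rule block_scheme_if_symbol_scheme[where \<Omega> = S.\<Omega> and A = S.alph and V = S.V and Z = S.Z and X = S.X and Y = S.Y
          and Vs = "\<lambda>_. S.Vs" and Zs = S.Zs and Xs = S.Xs and Ys = S.Ys])
      show "card S.alph \<le> 2 ^ F" "1 - card S.alph / 2 ^ F < \<epsilon>"
        using sz_le F0[OF F] by (simp_all add: card_alph)
      show "log 2 (card S.Vs) \<le> N * F"
      proof -
        have "log 2 (card S.Vs) = D * log 2 (q F)"
          using q_bounds(1)[of F] by (simp add: S.card_Vs log_nat_power)
        also have "\<dots> \<le> D * (N / D * F)"
          using q_bounds[of F] by (intro mult_left_mono) (simp_all add: log_le_iff)
        finally show ?thesis using D by simp
      qed
      show "log 2 (card (S.Zs S)) \<le> (\<Sum>s<Khat h r. \<tau> s * Mc h r D N s) * F" if S: "S \<in> users h r" for S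
      proof -
        have "real (card (S.Zs S)) \<le> 2 powr (\<Sum>s<K. real (r * D * a s) * (e s * F))"
          unfolding S.card_Zs[OF S] Sa K_def[symmetric] by (intro prod_power_le_powr p_bounds)
        moreover have "0 < card (S.Zs S)"
          unfolding S.card_Zs[OF S] using p_bounds by (intro prod_pos) auto
        ultimately have "log 2 (card (S.Zs S)) \<le> (\<Sum>s<K. real (r * D * a s) * (e s * F))"
          by (simp add: log_le_iff)
        also have "\<dots> = (\<Sum>s<K. \<tau> s * Mc h r D N s * F)"
        proof (rule sum.cong[OF refl])
          fix s assume "s \<in> {..<K}"
          then have s: "s < K" by simp
          have "real (a s) * (real K - real s) = real s * real (c s)"
            using real_binomial_diff[OF s] by (simp add: a_def c_def)
          then have as: "real (a s) = real s * real (c s) / (real K - real s)"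
            using s by (simp add: field_simps)
          \<comment> \<open>Per bit of a relay symbol the user caches \<open>s / (K - s)\<close>
            bits, for \<open>r\<close> relays and \<open>D\<close> files.\<close>
          have "real (r * D * a s) * (e s * F) = r * D * (real s / (real K - real s)) * (real (c s) * (e s * F))"
            by (simp add: as)
          also have "\<dots> = \<tau> s * Mc h r D N s * F"
            unfolding ce[OF s] using r by (simp add: Mc_def \<kappa>_def K_def)
          finally show "real (r * D * a s) * (e s * F) = \<tau> s * Mc h r D N s * F" .
        qed
        finally show ?thesis by (simp add: sum_distrib_right K_def)
      qed
      show "card (S.Xs j) \<le> 2 ^ nat \<lceil>(\<Sum>s<Khat h r. \<tau> s * R1c h r D N s) * F\<rceil>" if j: "j < h" for j
      proof (rule card_le_power_ceiling)
        have "real (card (S.Xs j)) \<le> 2 powr (\<Sum>s<K. real (K choose Suc s) * (e s * F))"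
          unfolding S.card_Xs[OF j] K_def[symmetric] by (intro prod_power_le_powr p_bounds)
        also have "(\<Sum>s<K. real (K choose Suc s) * (e s * F)) = (\<Sum>s<K. \<tau> s * R1c h r D N s * F)"
        proof (rule sum.cong[OF refl])
          fix s assume "s \<in> {..<K}"
          then have s: "s < K" by simp
          \<comment> \<open>The number of sums per message symbol is \<open>K / (s + 1)\<close>, the
            factor in \<open>R1c_eq\<close>.\<close>
          have "real (Suc s * (K choose Suc s)) = real (K * c s)"
            unfolding c_def by (simp only: binomial_absorption)
          then have "real (K choose Suc s) = real K * real (c s) / (s + 1)"
            by (simp add: field_simps)
          then have "real (K choose Suc s) * (e s * F) = real K / (s + 1) * (real (c s) * (e s * F))"
            by simp
          also have "\<dots> = \<tau> s * R1c h r D N s * F"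
            unfolding ce[OF s] using R1c_eq[OF r(1) D, of s h N] s by (simp add: \<kappa>_def K_def ac_simps)
          finally show "real (K choose Suc s) * (e s * F) = \<tau> s * R1c h r D N s * F" .
        qed
        finally show "real (card (S.Xs j)) \<le> 2 powr ((\<Sum>s<Khat h r. \<tau> s * R1c h r D N s) * F)"
          by (simp add: sum_distrib_right K_def)
      qed
      show "card (S.Ys j S) \<le> 2 ^ nat \<lceil>1 / r * F\<rceil>" if S: "S \<in> users h r" "j \<in> S" for S j
      proof (rule card_le_power_ceiling)
        have "real (\<Prod>s<K. nat (p F s) ^ c s) \<le> 2 powr (\<Sum>s<K. real (c s) * (e s * F))"
          by (intro prod_power_le_powr p_bounds)
        then have "real_of_int (q F) * real (\<Prod>s<K. nat (p F s) ^ c s) \<le> 2 powr (N / D * F) * 2 powr (\<kappa> / r * F)"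
          unfolding sum_ce using q_bounds[of F] by (intro mult_mono of_nat_0_le_iff) auto
        \<comment> \<open>The cached symbol of the requested file and the forwarded sums together
          fill the second link exactly.\<close>
        moreover have "N / D * F + \<kappa> / r * F = 1 / r * F"
          using r D by (simp add: \<kappa>_def field_simps)
        ultimately show "real (card (S.Ys j S)) \<le> 2 powr (1 / r * F)"
          unfolding S.card_Ys[OF S] Sc K_def[symmetric] using q_bounds(1)[of F]
          by (simp add: powr_add[symmetric])
      qed
      show "f (d S) = f' (d S)"
        if "S \<in> users h r" "d \<in> demands h r D" "f \<in> {..<D} \<rightarrow> S.alph" "f' \<in> {..<D} \<rightarrow> S.alph"
          "(S.Z S f u, \<lambda>j\<in>S. S.Y j d S (S.X j d f u) (S.V j f u)) =
           (S.Z S f' u', \<lambda>j\<in>S. S.Y j d S (S.X j d f' u') (S.V j f' u'))" for S d f f' u u'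
        using S.decodable[OF that(1-4), unfolded S.view_def] that(5) .
      show "map_pmf (\<lambda>u. (S.Z S f u, \<lambda>j\<in>S. S.Y j d S (S.X j d f u) (S.V j f u))) (pmf_of_set S.\<Omega>) =
          map_pmf (\<lambda>u. (S.Z S f' u, \<lambda>j\<in>S. S.Y j d S (S.X j d f' u) (S.V j f' u))) (pmf_of_set S.\<Omega>)"
        if "S \<in> users h r" "d \<in> demands h r D" "f (d S) = f' (d S)" for S d f f'
        using S.secure[OF that(1,2), of f f'] that(3) unfolding S.view_def[abs_def] by blast
    qed (use S.finite_\<Omega> S.\<Omega>_nonempty S.finite_alph S.alph_nonempty \<delta> S.V_in S.Z_in S.X_in S.Y_in
        S.finite_Vs S.finite_Zs S.finite_Xs S.finite_Ys in blast)+
  qed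
qed

text \<open>Weights are attached to indices rather than points, so that they serve as time-sharing
  weights even if \<open>g\<close> is not injective. The combinations form a convex set containing
  all \<open>g s\<close>, and the hull is minimal.\<close>

lemma convex_hull_image_lessThan:
  fixes g :: "nat \<Rightarrow> 'a :: real_vector"
  assumes "x \<in> convex hull (g ` {..<n})"
  obtains \<tau> where "\<And>s. s < n \<Longrightarrow> 0 \<le> \<tau> s" "(\<Sum>s<n. \<tau> s) = 1" "x = (\<Sum>s<n. \<tau> s *\<^sub>R g s)"
proof -
  define C where "C = {x. \<exists>\<tau>. (\<forall>s<n. 0 \<le> \<tau> s) \<and> (\<Sum>s<n. \<tau> s) = 1 \<and> x = (\<Sum>s<n. \<tau> s *\<^sub>R g s)}"
  have "convex hull (g ` {..<n}) \<subseteq> C"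
  proof (rule hull_minimal)
    show "g ` {..<n} \<subseteq> C"
    proof
      fix x assume "x \<in> g ` {..<n}"
      then obtain t where t: "t < n" "x = g t" by auto
      have "(\<Sum>s<n. (if s = t then 1 else 0) *\<^sub>R g s) = (\<Sum>s<n. if s = t then g s else 0)"
        by (intro sum.cong) auto
      then show "x \<in> C"
        unfolding C_def using t by (intro CollectI exI[of _ "\<lambda>s. if s = t then 1 else 0"]) simp
    qed
    show "convex C"
    proof (rule convexI)
      fix x y and u v :: real assume "x \<in> C" "y \<in> C" and uv: "0 \<le> u" "0 \<le> v" "u + v = 1"
      then obtain \<tau> \<mu> where l: "\<forall>s<n. 0 \<le> \<tau> s" "(\<Sum>s<n. \<tau> s) = 1" "x = (\<Sum>s<n. \<tau> s *\<^sub>R g s)"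
        and m: "\<forall>s<n. 0 \<le> \<mu> s" "(\<Sum>s<n. \<mu> s) = 1" "y = (\<Sum>s<n. \<mu> s *\<^sub>R g s)"
        unfolding C_def by auto
      show "u *\<^sub>R x + v *\<^sub>R y \<in> C"
        unfolding C_def
      proof (intro CollectI exI[of _ "\<lambda>s. u * \<tau> s + v * \<mu> s"] conjI)
        show "\<forall>s<n. 0 \<le> u * \<tau> s + v * \<mu> s" using l m uv by simp
        show "(\<Sum>s<n. u * \<tau> s + v * \<mu> s) = 1"
          using l m uv by (simp add: sum.distrib sum_distrib_left[symmetric])
        show "u *\<^sub>R x + v *\<^sub>R y = (\<Sum>s<n. (u * \<tau> s + v * \<mu> s) *\<^sub>R g s)"
          unfolding l(3) m(3) by (simp add: scaleR_sum_right scaleR_left_distrib sum.distrib)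
      qed
    qed
  qed
  with assms have "x \<in> C" by blast
  then show thesis using that unfolding C_def by blast
qed

text \<open>The point of parameter \<open>t\<close> lies in the hull, so both claims follow from
  time sharing; the third coordinate stays \<open>1 / r\<close> because the weights sum to
  1.\<close>

theorem theorem4:
  fixes h r D t :: nat and N :: real
  assumes "0 < r" and "r < h" and "h choose r \<le> D"
    and "0 \<le> N" and "N \<le> real D / real r"
    and "t < Khat h r"
  shows "secure_achievable h r D (Mc h r D N t) N (R1c h r D N t) (1 / real r) \<and>
    (\<forall>p \<in> convex hull {(Mc h r D N s, R1c h r D N s, 1 / real r) | s. s < Khat h r}.
       secure_achievable h r D (fst p) N (fst (snd p)) (snd (snd p)))"
proof -
  have "0 < h choose r" using assms(2) by simp
  then have D: "0 < D" using assms(3) by linarith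
  define g where "g s = (Mc h r D N s, R1c h r D N s, 1 / real r)" for s
  have hull: "{(Mc h r D N s, R1c h r D N s, 1 / real r) | s. s < Khat h r} = g ` {..<Khat h r}"
    by (auto simp: g_def)
  have ach: "secure_achievable h r D (fst x) N (fst (snd x)) (snd (snd x))"
    if x: "x \<in> convex hull (g ` {..<Khat h r})" for x
  proof -
    from convex_hull_image_lessThan[OF x] obtain \<tau>
      where l: "\<And>s. s < Khat h r \<Longrightarrow> 0 \<le> \<tau> s" "(\<Sum>s<Khat h r. \<tau> s) = 1"
        "x = (\<Sum>s<Khat h r. \<tau> s *\<^sub>R g s)" by blast
    have "fst x = (\<Sum>s<Khat h r. \<tau> s * Mc h r D N s)"
      "fst (snd x) = (\<Sum>s<Khat h r. \<tau> s * R1c h r D N s)"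
      unfolding l(3) by (simp_all add: fst_sum snd_sum g_def)
    moreover have "snd (snd x) = 1 / r"
      using l(2) unfolding l(3) by (simp add: snd_sum g_def sum_divide_distrib[symmetric])
    ultimately show ?thesis
      using time_shared_secure_achievable[OF assms(1,2) D assms(4,5) l(1,2)] by simp
  qed
  have "g t \<in> convex hull (g ` {..<Khat h r})" using assms(6) by (intro hull_inc) simp
  from ach[OF this] ach show ?thesis unfolding hull by (simp add: g_def)
qed

end
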